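(* Let $\Omega\subset\mathbb{R}^n$ ($n\ge 2$) be a rectangular domain, i.e. up to a rigid motion $\Omega=\prod_{i=1}^n(-L_i,L_i)$ with $L_i>0$, and let $u$ be the torsion function of $\Omega$. Then the maximal norm of the gradient of $u$ is located only at the centers of the faces of $\Omega$ of largest $(n-1)$-volume.
   Context: The torsion function of a bounded domain $\Omega$ is the solution $u$ of $-\Delta u=1$ in $\Omega$, $u=0$ on $\partial\Omega$; for a rectangular domain it is $C^1$ up to the boundary and the maximum of $|\nabla u|$ is taken over $\overline\Omega$. The faces of $\prod_i(-L_i,L_i)$ are its $2n$ faces of dimension $n-1$, lying in $\{x_i=\pm L_i\}$, with centers $\pm L_i e_i$. *)

theory Defs
  imports "HOL-Analysis.Analysis"
begin

(* At a point of the closure of a nonempty open box the derivative within the closure is unique,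
   so on a closed box this is the gradient up to the boundary; inside it is the usual gradient. *)
definition gradient_within ::
    "(real ^ 'n \<Rightarrow> real) \<Rightarrow> (real ^ 'n) set \<Rightarrow> real ^ 'n \<Rightarrow> real ^ 'n" where
  "gradient_within u S x = (THE D. (u has_derivative (\<lambda>h. D \<bullet> h)) (at x within S))"

abbreviation gradient :: "(real ^ 'n \<Rightarrow> real) \<Rightarrow> real ^ 'n \<Rightarrow> real ^ 'n" where
  "gradient u \<equiv> gradient_within u UNIV"

definition hessian :: "(real ^ 'n \<Rightarrow> real) \<Rightarrow> real ^ 'n \<Rightarrow> real ^ 'n ^ 'n" where
  "hessian u x = jacobian (gradient u) (at x)"

definition laplacian :: "(real ^ 'n \<Rightarrow> real) \<Rightarrow> real ^ 'n \<Rightarrow> real" where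
  "laplacian u x = trace (hessian u x)"

(* Meant for open sets only. *)
definition C2_on :: "(real ^ 'n) set \<Rightarrow> (real ^ 'n \<Rightarrow> real) \<Rightarrow> bool" where
  "C2_on \<Omega> u \<longleftrightarrow>
     u differentiable_on \<Omega> \<and> gradient u differentiable_on \<Omega> \<and> continuous_on \<Omega> (hessian u)"

(* Classical solution; regularity of the gradient up to the boundary is not part of the definition.
   Values of u outside the closure are irrelevant. *)
definition torsion_function :: "(real ^ 'n) set \<Rightarrow> (real ^ 'n \<Rightarrow> real) \<Rightarrow> bool" where
  "torsion_function \<Omega> u \<longleftrightarrow>
     C2_on \<Omega> u \<and> continuous_on (closure \<Omega>) u \<and>
     (\<forall>x\<in>\<Omega>. - laplacian u x = 1) \<and> (\<forall>x\<in>frontier \<Omega>. u x = 0)"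

(* The sign s is 1 or -1. *)
definition box_face :: "real ^ 'n \<Rightarrow> 'n \<Rightarrow> real \<Rightarrow> (real ^ 'n) set" where
  "box_face L i s = {x \<in> cbox (- L) L. x $ i = s * L $ i}"

definition face_center :: "real ^ 'n \<Rightarrow> 'n \<Rightarrow> real \<Rightarrow> real ^ 'n" where
  "face_center L i s = axis i (s * L $ i)"

(* (n-1)-dimensional Lebesgue measure of a subset of a hyperplane on which the coordinate x_i is
   constant: drop that coordinate. *)
definition hyperplane_volume :: "'n \<Rightarrow> (real ^ 'n) set \<Rightarrow> real" where
  "hyperplane_volume i F =
     measure (Pi\<^sub>M (- {i}) (\<lambda>_. lborel)) ((\<lambda>x. restrict (\<lambda>j. x $ j) (- {i})) ` F)"

definition largest_face :: "real ^ 'n \<Rightarrow> 'n \<Rightarrow> real \<Rightarrow> bool" where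
  "largest_face L i s \<longleftrightarrow>
     s \<in> {1, -1} \<and>
     (\<forall>j. \<forall>t\<in>{1, -1}.
        hyperplane_volume j (box_face L j t) \<le> hyperplane_volume i (box_face L i s))"

lemma hyperplane_volume_box_face:
  fixes L :: "real ^ 'n"
  assumes "\<And>j. L $ j > 0" and "s \<in> {1, -1}"
  shows "hyperplane_volume i (box_face L i s) = (\<Prod>j\<in>- {i}. 2 * L $ j)"
proof -
  interpret product_sigma_finite "\<lambda>_ :: 'n. lborel :: real measure"
    by unfold_locales
  have "(\<lambda>x. restrict (\<lambda>j. x $ j) (- {i})) ` box_face L i s
      = (\<Pi>\<^sub>E j\<in>- {i}. {- (L $ j)..L $ j})" (is "?A = ?B")
  proof (intro subset_antisym subsetI)
    fix y assume "y \<in> ?A"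
    then show "y \<in> ?B" by (auto simp: box_face_def mem_box_cart PiE_iff)
  next
    fix y assume y: "y \<in> ?B"
    define x :: "real ^ 'n" where "x = (\<chi> j. if j = i then s * L $ i else y j)"
    have "- (L $ j) \<le> x $ j \<and> x $ j \<le> L $ j" for j
      using y assms(1)[of i] assms(2) by (cases "j = i") (auto simp: x_def PiE_iff)
    then have "x \<in> box_face L i s"
      by (auto simp: box_face_def mem_box_cart x_def)
    moreover have "y = restrict (\<lambda>j. x $ j) (- {i})"
      using y by (auto simp: x_def PiE_iff extensional_def fun_eq_iff)
    ultimately show "y \<in> ?A" by blast
  qed
  then have "hyperplane_volume i (box_face L i s)
      = measure (Pi\<^sub>M (- {i}) (\<lambda>_. lborel)) (\<Pi>\<^sub>E j\<in>- {i}. {- (L $ j)..L $ j})"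
    by (simp add: hyperplane_volume_def)
  also have "\<dots> = (\<Prod>j\<in>- {i}. 2 * L $ j)"
  proof -
    have "emeasure (Pi\<^sub>M (- {i}) (\<lambda>_. lborel)) (\<Pi>\<^sub>E j\<in>- {i}. {- (L $ j)..L $ j})
        = (\<Prod>j\<in>- {i}. ennreal (2 * L $ j))"
      using assms(1) by (subst emeasure_PiM) (auto simp: less_imp_le intro!: prod.cong)
    also have "\<dots> = ennreal (\<Prod>j\<in>- {i}. 2 * L $ j)"
      using assms(1) by (intro prod_ennreal) (simp add: less_imp_le)
    finally show ?thesis
      using assms(1) by (simp add: measure_def less_imp_le prod_nonneg)
  qed
  finally show ?thesis .
qed

definition max_gradient_points :: "(real ^ 'n) set \<Rightarrow> (real ^ 'n \<Rightarrow> real) \<Rightarrow> (real ^ 'n) set" where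
  "max_gradient_points \<Omega> u =
     {x \<in> closure \<Omega>. \<forall>y \<in> closure \<Omega>.
        norm (gradient_within u (closure \<Omega>) y) \<le> norm (gradient_within u (closure \<Omega>) x)}"

end

(*
After a rigid motion the domain is the box prod_i [-L_i, L_i]. Only the weak maximum principle is
used, always with explicit comparison functions.

Differentiability up to the boundary: the tangential increments u(x + h) - u(x) are harmonic and
vanish on a face, so a barrier bounds them by C |h| y, where y is the distance to the face. Then
u / y is Lipschitz along the face, and a second barrier shows that it converges as y tends to 0. The
limit is the slope of u at the face. At edges a quadratic bound makes the gradient vanish.

Comparison of slopes: reflecting x_j about a hyperplane x_j = const > 0 shows that the slope strictly
increases when a nonzero coordinate of the face point is replaced by 0, so it is maximal exactly at the
center. If L_i < L_j, the reflection exchanging the i-th and j-th directions and mapping the face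
x_j = L_j into the face x_i = L_i compares the center of the former with a non-central point of the
latter. So the largest slope M is attained exactly at the centers of the faces with smallest L_i,
which are the faces of largest volume.

Interior points: for a unit vector v, u(x + t v) - u(x) is harmonic and bounded on the boundary by
(M + o(1)) t, and it is nonpositive wherever x + t v lies on the boundary. A subharmonic
comparison function b with 0 < b(x) then improves the bound to (M + o(1)) t (1 - b(x)), so |grad u| < M.
*)

theory Submission imports Defs begin

section \<open>Coordinatewise Laplacians and the maximum principle\<close>

text \<open>The obstacle is regularity: \<open>u\<close> is only known to be C2 inside and
  continuous up to the boundary. Subharmonicity of |grad u|^2 would need third derivatives and
  boundary values of the gradient. Increments of \<open>u\<close> avoid both: they are harmonic
  because the two source terms cancel, and their boundary values can be estimated from
  \<open>u\<close> itself. Strictness, which usually comes from the Hopf lemma or the strong maximum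
  principle, is obtained quantitatively. Products of one-variable eigenfunctions, either all cosines
  or cosines with one sinh that grows fast enough to outweigh them, serve as explicit subsolutions.
  They vanish only linearly at the faces, so a gap in \<open>u\<close> survives division by the
  depth and becomes a gap between slopes.\<close>

definition has_d2 :: "(real \<Rightarrow> real) \<Rightarrow> real \<Rightarrow> bool" where
  "has_d2 \<phi> m \<longleftrightarrow> (\<exists>d. (\<forall>\<^sub>F t in nhds 0. (\<phi> has_real_derivative d t) (at t)) \<and>
     (d has_real_derivative m) (at 0))"

text \<open>Second derivatives are required along coordinate lines only; this suffices for the maximum
  principle and reduces every barrier to one-variable calculus.\<close>

definition has_lap :: "(real ^ 'n \<Rightarrow> real) \<Rightarrow> real \<Rightarrow> real ^ 'n \<Rightarrow> bool" where
  "has_lap v l x \<longleftrightarrow>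
     (\<exists>m. l = (\<Sum>k\<in>UNIV. m k) \<and> (\<forall>k. has_d2 (\<lambda>t. v (x + t *\<^sub>R axis k 1)) (m k)))"

lemma has_d2I:
  assumes "\<And>t. (\<phi> has_real_derivative d t) (at t)" "(d has_real_derivative m) (at 0)"
  shows "has_d2 \<phi> m"
  unfolding has_d2_def by (intro exI[of _ d]) (use assms in auto)

lemma has_d2_const: "has_d2 (\<lambda>t. c) 0"
  by (rule has_d2I[where d = "\<lambda>t. 0"]) auto

lemma has_d2_add:
  assumes "has_d2 f m" "has_d2 g m'"
  shows "has_d2 (\<lambda>t. f t + g t) (m + m')"
proof -
  obtain d d' where d: "\<forall>\<^sub>F t in nhds 0. (f has_real_derivative d t) (at t)"
      "(d has_real_derivative m) (at 0)"
    and d': "\<forall>\<^sub>F t in nhds 0. (g has_real_derivative d' t) (at t)"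
      "(d' has_real_derivative m') (at 0)"
    using assms unfolding has_d2_def by blast
  have "\<forall>\<^sub>F t in nhds 0. ((\<lambda>t. f t + g t) has_real_derivative d t + d' t) (at t)"
    using d(1) d'(1) by eventually_elim (auto intro: DERIV_add)
  moreover have "((\<lambda>t. d t + d' t) has_real_derivative m + m') (at 0)"
    using d(2) d'(2) by (rule DERIV_add)
  ultimately show ?thesis unfolding has_d2_def by (intro exI[of _ "\<lambda>t. d t + d' t"]) auto
qed

lemma has_d2_cmult:
  assumes "has_d2 f m"
  shows "has_d2 (\<lambda>t. c * f t) (c * m)"
proof -
  obtain d where d: "\<forall>\<^sub>F t in nhds 0. (f has_real_derivative d t) (at t)"
      "(d has_real_derivative m) (at 0)"
    using assms unfolding has_d2_def by blast
  have "\<forall>\<^sub>F t in nhds 0. ((\<lambda>t. c * f t) has_real_derivative c * d t) (at t)"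
    using d(1) by eventually_elim (auto intro: DERIV_cmult)
  moreover have "((\<lambda>t. c * d t) has_real_derivative c * m) (at 0)"
    using d(2) by (rule DERIV_cmult)
  ultimately show ?thesis unfolding has_d2_def by (intro exI[of _ "\<lambda>t. c * d t"]) auto
qed

lemma has_d2_mirror:
  assumes "has_d2 f m"
  shows "has_d2 (\<lambda>t. f (- t)) m"
proof -
  obtain d where d: "\<forall>\<^sub>F t in nhds 0. (f has_real_derivative d t) (at t)"
      "(d has_real_derivative m) (at 0)"
    using assms unfolding has_d2_def by blast
  have "\<forall>\<^sub>F t in filtermap uminus (nhds 0). (f has_real_derivative d t) (at t)"
    using d(1) by (simp add: filtermap_nhds_minus)
  then have "\<forall>\<^sub>F t in nhds 0. (f has_real_derivative d (- t)) (at (- t))"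
    by (simp add: eventually_filtermap)
  then have "\<forall>\<^sub>F t in nhds 0. ((\<lambda>t. f (- t)) has_real_derivative - d (- t)) (at t)"
    by eventually_elim (rule iffD1[OF DERIV_mirror])
  moreover have "((\<lambda>t. - d (- t)) has_real_derivative m) (at 0)"
    using DERIV_minus[OF iffD1[OF DERIV_mirror[of d m 0]]] d(2) by simp
  ultimately show ?thesis unfolding has_d2_def
    by (intro exI[of _ "\<lambda>t. - d (- t)"]) auto
qed

text \<open>If m were positive, the derivative, which is 0 at the maximum, would be positive just to
  the right of 0, and the mean value theorem would make \<phi> exceed \<phi> 0 there.\<close>

lemma has_d2_local_max:
  assumes "has_d2 \<phi> m" and max: "\<forall>\<^sub>F t in nhds 0. \<phi> t \<le> \<phi> 0"
  shows "m \<le> 0"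
proof (rule ccontr)
  assume "\<not> m \<le> 0"
  obtain d where d: "\<forall>\<^sub>F t in nhds 0. (\<phi> has_real_derivative d t) (at t)"
      "(d has_real_derivative m) (at 0)"
    using assms unfolding has_d2_def by blast
  obtain e where e: "e > 0"
    "\<And>t. \<bar>t\<bar> < e \<Longrightarrow> (\<phi> has_real_derivative d t) (at t) \<and> \<phi> t \<le> \<phi> 0"
    using eventually_conj[OF d(1) max] by (auto simp: eventually_nhds_metric dist_real_def)
  have "d 0 = 0"
    using e by (intro DERIV_local_max[of \<phi> "d 0" 0 e]) auto
  obtain e' where e': "e' > 0" "\<And>h. 0 < h \<Longrightarrow> h < e' \<Longrightarrow> d 0 < d (0 + h)"
    using DERIV_pos_inc_right[OF d(2)] \<open>\<not> m \<le> 0\<close> by auto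
  define b where "b = min e e' / 2"
  have b: "0 < b" "b < e" "b < e'" using e(1) e'(1) by (auto simp: b_def)
  obtain z where z: "0 < z" "z < b" "\<phi> b - \<phi> 0 = (b - 0) * d z"
    using MVT2[OF b(1), of \<phi> d] e(2) b by force
  have "d z > 0" using e'(2)[of z] z b \<open>d 0 = 0\<close> by simp
  then have "\<phi> b > \<phi> 0" using z(3) b(1) by (simp add: algebra_simps)
  then show False using e(2)[of b] b by simp
qed

lemma has_lap_const: "has_lap (\<lambda>x. c) 0 x"
  unfolding has_lap_def by (intro exI[of _ "\<lambda>_. 0"]) (simp add: has_d2_const)

lemma has_lap_add:
  assumes "has_lap f a x" "has_lap g b x"
  shows "has_lap (\<lambda>x. f x + g x) (a + b) x"
proof -
  obtain m m' where "a = (\<Sum>k\<in>UNIV. m k)" "\<And>k. has_d2 (\<lambda>t. f (x + t *\<^sub>R axis k 1)) (m k)"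
    "b = (\<Sum>k\<in>UNIV. m' k)" "\<And>k. has_d2 (\<lambda>t. g (x + t *\<^sub>R axis k 1)) (m' k)"
    using assms unfolding has_lap_def by blast
  then show ?thesis
    unfolding has_lap_def
    by (intro exI[of _ "\<lambda>k. m k + m' k"]) (simp add: sum.distrib has_d2_add)
qed

lemma has_lap_cmult:
  assumes "has_lap f a x"
  shows "has_lap (\<lambda>x. c * f x) (c * a) x"
proof -
  obtain m where "a = (\<Sum>k\<in>UNIV. m k)" "\<And>k. has_d2 (\<lambda>t. f (x + t *\<^sub>R axis k 1)) (m k)"
    using assms unfolding has_lap_def by blast
  then show ?thesis
    unfolding has_lap_def
    by (intro exI[of _ "\<lambda>k. c * m k"]) (simp add: sum_distrib_left has_d2_cmult)
qed

lemma has_lap_diff: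
  assumes "has_lap f a x" "has_lap g b x"
  shows "has_lap (\<lambda>x. f x - g x) (a - b) x"
  using has_lap_add[OF assms(1) has_lap_cmult[OF assms(2), of "-1"]] by simp

lemma has_lap_minus:
  assumes "has_lap f a x"
  shows "has_lap (\<lambda>x. - f x) (- a) x"
  using has_lap_cmult[OF assms, of "-1"] by simp

lemma has_lap_sum:
  assumes "finite I" "\<And>i. i \<in> I \<Longrightarrow> has_lap (f i) (a i) x"
  shows "has_lap (\<lambda>x. \<Sum>i\<in>I. f i x) (\<Sum>i\<in>I. a i) x"
  using assms
proof (induction I rule: finite_induct)
  case empty
  show ?case by (simp add: has_lap_const)
next
  case (insert i I)
  have "has_lap (\<lambda>x. f i x + (\<Sum>i\<in>I. f i x)) (a i + (\<Sum>i\<in>I. a i)) x"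
    using insert by (intro has_lap_add) auto
  then show ?case using insert.hyps by simp
qed

lemma has_lap_coord:
  fixes x :: "real ^ 'n"
  assumes "\<And>t. (g has_real_derivative g' t) (at t)" "(g' has_real_derivative m) (at (x $ k))"
  shows "has_lap (\<lambda>x. g (x $ k)) m x"
proof -
  have 1: "has_d2 (\<lambda>t. g (x $ k + t)) m"
  proof (rule has_d2I)
    show "((\<lambda>t. g (x $ k + t)) has_real_derivative g' (x $ k + t)) (at t)" for t
      using iffD1[OF DERIV_shift assms(1)[of "t + x $ k"]] by (simp add: add.commute)
    show "((\<lambda>t. g' (x $ k + t)) has_real_derivative m) (at 0)"
      using iffD1[OF DERIV_shift, of g' m 0 "x $ k"] assms(2) by (simp add: add.commute)
  qed
  have "has_d2 (\<lambda>t. g ((x + t *\<^sub>R axis j 1) $ k)) (if j = k then m else 0)" for j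
    using 1 by (auto simp: axis_def has_d2_const)
  then show ?thesis
    unfolding has_lap_def by (intro exI[of _ "\<lambda>j. if j = k then m else 0"]) auto
qed

text \<open>Each factor is an eigenfunction of the second derivative, and the eigenvalues add up.
  Negative \<open>c k\<close> gives cosines, positive \<open>c k\<close> hyperbolic functions, and
  \<open>c k = 0\<close> affine factors; all three occur below.\<close>

lemma has_lap_prod:
  fixes x :: "real ^ 'n" and c :: "'n \<Rightarrow> real"
  assumes "\<And>k t. (g k has_real_derivative g' k t) (at t)"
    and "\<And>k t. (g' k has_real_derivative c k * g k t) (at t)"
  shows "has_lap (\<lambda>x. \<Prod>k\<in>UNIV. g k (x $ k))
    ((\<Sum>k\<in>UNIV. c k) * (\<Prod>k\<in>UNIV. g k (x $ k))) x"
proof -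
  have "has_d2 (\<lambda>t. \<Prod>k\<in>UNIV. g k ((x + t *\<^sub>R axis j 1) $ k)) (c j * (\<Prod>k\<in>UNIV. g k (x $ k)))" for j
  proof -
    let ?P = "\<Prod>k\<in>UNIV-{j}. g k (x $ k)"
    have eq: "(\<Prod>k\<in>UNIV. g k ((x + t *\<^sub>R axis j 1) $ k)) = ?P * g j (x $ j + t)" for t
      by (subst prod.remove[of _ j]) (auto simp: axis_def intro!: prod.cong)
    have "has_d2 (\<lambda>t. g j (x $ j + t)) (c j * g j (x $ j))"
    proof (rule has_d2I)
      show "((\<lambda>t. g j (x $ j + t)) has_real_derivative g' j (x $ j + t)) (at t)" for t
        using iffD1[OF DERIV_shift assms(1)[of j "t + x $ j"]] by (simp add: add.commute)
      show "((\<lambda>t. g' j (x $ j + t)) has_real_derivative c j * g j (x $ j)) (at 0)"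
        using iffD1[OF DERIV_shift, of "g' j" "c j * g j (x $ j)" 0 "x $ j"] assms(2)[of j "x $ j"]
        by (simp add: add.commute)
    qed
    from has_d2_cmult[OF this, of ?P]
    have "has_d2 (\<lambda>t. ?P * g j (x $ j + t)) (c j * (?P * g j (x $ j)))"
      by (simp add: mult_ac)
    moreover have "?P * g j (x $ j) = (\<Prod>k\<in>UNIV. g k (x $ k))"
      using eq[of 0] by simp
    ultimately show ?thesis unfolding eq by simp
  qed
  then show ?thesis
    unfolding has_lap_def
    by (intro exI[of _ "\<lambda>j. c j * (\<Prod>k\<in>UNIV. g k (x $ k))"]) (auto simp: sum_distrib_right)
qed

lemma has_lap_translate:
  assumes "has_lap v l (x + h)"
  shows "has_lap (\<lambda>x. v (x + h)) l x"
  using assms unfolding has_lap_def by (simp add: add_ac)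

text \<open>Signed permutations followed by translations send coordinate lines to coordinate lines,
  so they respect a Laplacian that only sees such lines. This covers sign flips, reflections in one
  coordinate and the exchange of two coordinates.\<close>

lemma has_lap_signed_perm:
  fixes x b :: "real ^ 'n" and s :: "'n \<Rightarrow> real" and \<pi> :: "'n \<Rightarrow> 'n"
  assumes \<pi>: "bij \<pi>" and s: "\<And>k. s k \<in> {1, -1}"
    and lap: "has_lap v l (\<chi> k. s k * x $ \<pi> k + b $ k)"
  shows "has_lap (\<lambda>x. v (\<chi> k. s k * x $ \<pi> k + b $ k)) l x"
proof -
  let ?\<Phi> = "\<lambda>x. \<chi> k. s k * x $ \<pi> k + b $ k"
  obtain m where m: "l = (\<Sum>k\<in>UNIV. m k)" "\<And>k. has_d2 (\<lambda>t. v (?\<Phi> x + t *\<^sub>R axis k 1)) (m k)"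
    using lap unfolding has_lap_def by blast
  have "has_d2 (\<lambda>t. v (?\<Phi> (x + t *\<^sub>R axis (\<pi> j) 1))) (m j)" for j
  proof -
    have eq: "?\<Phi> (x + t *\<^sub>R axis (\<pi> j) 1) = ?\<Phi> x + (s j * t) *\<^sub>R axis j 1" for t
      by (auto simp: vec_eq_iff axis_def algebra_simps inj_eq[OF bij_is_inj[OF \<pi>]])
    consider "s j = 1" | "s j = -1" using s by blast
    then have "has_d2 (\<lambda>t. v (?\<Phi> x + (s j * t) *\<^sub>R axis j 1)) (m j)"
      by cases (simp_all add: m(2)[of j] has_d2_mirror[OF m(2)[of j], simplified])
    then show ?thesis unfolding eq .
  qed
  from this[of "inv \<pi> j" for j]
  have *: "has_d2 (\<lambda>t. v (?\<Phi> (x + t *\<^sub>R axis j 1))) (m (inv \<pi> j))" for j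
    by (simp only: surj_f_inv_f[OF bij_is_surj[OF \<pi>]])
  have "l = (\<Sum>j\<in>UNIV. m (inv \<pi> j))"
    unfolding m(1) by (rule sum.reindex_bij_betw[symmetric, OF bij_imp_bij_inv[OF \<pi>]])
  then show ?thesis
    unfolding has_lap_def by (intro exI[of _ "\<lambda>j. m (inv \<pi> j)"] conjI allI *)
qed

lemma has_lap_norm_square: "has_lap (\<lambda>x::real^'n. (norm x)\<^sup>2) (2 * real CARD('n)) x"
proof -
  have eq: "(norm x)\<^sup>2 = (\<Sum>k\<in>UNIV. (x $ k)\<^sup>2)" for x :: "real^'n"
    by (simp add: norm_vec_def L2_set_def sum_nonneg)
  have "has_lap (\<lambda>x::real^'n. \<Sum>k\<in>UNIV. (x $ k)\<^sup>2) (\<Sum>k\<in>(UNIV::'n set). 2) x"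
    by (intro has_lap_sum has_lap_coord[where g = "\<lambda>t. t\<^sup>2" and g' = "\<lambda>t. 2 * t"])
       (auto intro!: derivative_eq_intros)
  then show ?thesis by (simp add: eq mult.commute)
qed

text \<open>Nothing is assumed about \<open>v\<close> off \<open>S\<close>; the points of \<open>S - G\<close> play the role of the boundary.\<close>

lemma maximum_principle:
  fixes v :: "real ^ 'n \<Rightarrow> real"
  assumes S: "compact S" "continuous_on S v" and G: "open G" "G \<subseteq> S"
    and bdry: "\<And>x. x \<in> S - G \<Longrightarrow> v x \<le> 0"
    and lap: "\<And>x. x \<in> G \<Longrightarrow> \<exists>l\<ge>0. has_lap v l x"
    and x: "x \<in> S"
  shows "v x \<le> 0"
proof (rule ccontr)
  assume "\<not> v x \<le> 0"
  obtain B where B: "B > 0" "\<And>y. y \<in> S \<Longrightarrow> norm y \<le> B"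
    using compact_imp_bounded[OF S(1)] unfolding bounded_pos by blast
  \<comment> \<open>Adding \<open>e * (norm y)\<^sup>2\<close> makes the Laplacian strictly
    positive. The added term stays below \<open>v x\<close>, so the maximum point of the perturbed
    function still has v > 0 and lies in \<open>G\<close>.\<close>
  define e where "e = v x / (2 * B\<^sup>2)"
  have e: "e > 0" "e * B\<^sup>2 < v x"
    using \<open>\<not> v x \<le> 0\<close> B(1) by (auto simp: e_def)
  define w where "w = (\<lambda>y. v y + e * (norm y)\<^sup>2)"
  have "continuous_on S w" unfolding w_def by (intro continuous_intros S)
  then obtain p where p: "p \<in> S" "\<And>y. y \<in> S \<Longrightarrow> w y \<le> w p"
    using continuous_attains_sup[of S w] S(1) x by blast
  have "v x \<le> w x" using e by (simp add: w_def)
  also have "\<dots> \<le> w p" using p x by blast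
  finally have "v x \<le> v p + e * (norm p)\<^sup>2" by (simp add: w_def)
  moreover have "e * (norm p)\<^sup>2 \<le> e * B\<^sup>2"
    using B(2)[OF p(1)] e(1) by (intro mult_left_mono power_mono) auto
  ultimately have "v p > 0" using e(2) by linarith
  then have pG: "p \<in> G" using bdry p(1) by force
  obtain l where l: "l \<ge> 0" "has_lap v l p" using lap[OF pG] by blast
  have "has_lap w (l + e * (2 * real CARD('n))) p"
    unfolding w_def by (intro has_lap_add has_lap_cmult has_lap_norm_square l)
  then obtain m where m: "l + e * (2 * real CARD('n)) = (\<Sum>k\<in>UNIV. m k)"
      "\<And>k. has_d2 (\<lambda>t. w (p + t *\<^sub>R axis k 1)) (m k)"
    unfolding has_lap_def by blast
  have "m k \<le> 0" for k
  proof (rule has_d2_local_max[OF m(2)])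
    have "((\<lambda>t. p + t *\<^sub>R axis k 1) \<longlongrightarrow> p + 0 *\<^sub>R axis k 1) (nhds 0)"
      by (intro tendsto_intros) (simp add: filterlim_ident)
    then have "\<forall>\<^sub>F t in nhds 0. p + t *\<^sub>R axis k 1 \<in> G"
      using topological_tendstoD G(1) pG by fastforce
    then show "\<forall>\<^sub>F t in nhds 0. w (p + t *\<^sub>R axis k 1) \<le> w (p + 0 *\<^sub>R axis k 1)"
      by eventually_elim (use p(2) G(2) in auto)
  qed
  then have "(\<Sum>k\<in>UNIV. m k) \<le> 0" by (intro sum_nonpos) auto
  moreover have "e * (2 * real CARD('n)) > 0" using e(1) by simp
  ultimately show False using m(1) l(1) by linarith
qed

lemma maximum_principle_cbox:
  fixes v :: "real ^ 'n \<Rightarrow> real" and a b :: "real ^ 'n"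
  assumes "continuous_on (cbox a b) v"
    and "\<And>x. x \<in> box a b \<Longrightarrow> \<exists>l\<ge>0. has_lap v l x"
    and bdry: "\<And>x k. x \<in> cbox a b \<Longrightarrow> x $ k = a $ k \<or> x $ k = b $ k \<Longrightarrow> v x \<le> 0"
    and "x \<in> cbox a b"
  shows "v x \<le> 0"
proof (rule maximum_principle[of "cbox a b" v "box a b"])
  fix x assume "x \<in> cbox a b - box a b"
  then have x: "x \<in> cbox a b" "\<not> x \<in> box a b" by auto
  then have "\<exists>k. x $ k = a $ k \<or> x $ k = b $ k"
    unfolding mem_box_cart by (metis less_le)
  then show "v x \<le> 0" using bdry x(1) by blast
qed (use assms in \<open>auto simp: mem_box_cart less_imp_le\<close>)

section \<open>Boundary barriers\<close>

text \<open>The comparison function is affine in the depth \<open>y = T - x\<^sub>i\<close>, plus a tangential paraboloid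
  that dominates the lateral sides and whose Laplacian is absorbed by the term \<open>y (r - y)\<close>.\<close>

lemma boundary_barrier:
  fixes v :: "real ^ 'n \<Rightarrow> real" and p :: "real ^ 'n" and i :: 'n
    and R T r A q N :: real
  defines "S \<equiv> {x. (\<forall>k. k \<noteq> i \<longrightarrow> \<bar>x $ k - p $ k\<bar> \<le> R) \<and> T - r \<le> x $ i \<and> x $ i \<le> T}"
  assumes R: "R > 0" and r: "r > 0" and A: "A \<ge> 0" and q: "q \<ge> 0" and N: "N \<ge> 0"
    and cont: "continuous_on S v"
    and lap: "\<And>x. (\<And>k. k \<noteq> i \<Longrightarrow> \<bar>x $ k - p $ k\<bar> < R) \<Longrightarrow> T - r < x $ i \<Longrightarrow> x $ i < T \<Longrightarrow>
      \<exists>l\<ge>- N. has_lap v l x"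
    and top: "\<And>x. x \<in> S \<Longrightarrow> x $ i = T \<Longrightarrow> v x \<le> 0"
    and bot: "\<And>x. x \<in> S \<Longrightarrow> x $ i = T - r \<Longrightarrow> v x \<le> A"
    and all: "\<And>x. x \<in> S \<Longrightarrow> v x \<le> q"
    and x: "x \<in> S" "\<And>k. k \<noteq> i \<Longrightarrow> x $ k = p $ k"
  shows "v x \<le> A * (T - x $ i) / r
    + (real CARD('n) * q / R\<^sup>2 + N / 2) * ((T - x $ i) * (r - (T - x $ i)))"
proof -
  define a :: "real ^ 'n" where "a = (\<chi> k. if k = i then T - r else p $ k - R)"
  define b :: "real ^ 'n" where "b = (\<chi> k. if k = i then T else p $ k + R)"
  have S: "S = cbox a b"
    unfolding S_def set_eq_iff mem_box_cart by (auto simp: a_def b_def abs_le_iff split: if_splits) (smt (verit))+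
  let ?n = "real CARD('n)"
  \<comment> \<open>The Laplacian -2c of the depth term pays for at most 2 n q / R^2 from the
    paraboloid and for the defect N.\<close>
  define c where "c = ?n * q / R\<^sup>2 + N / 2"
  have c: "c \<ge> 0" using q N by (simp add: c_def)
  define \<beta>1 where "\<beta>1 = (\<lambda>x::real^'n. A * (T - x $ i) / r + c * ((T - x $ i) * (r - (T - x $ i))))"
  define \<beta>2 where "\<beta>2 = (\<lambda>x::real^'n. \<Sum>k\<in>UNIV - {i}. q / R\<^sup>2 * (x $ k - p $ k)\<^sup>2)"
  have \<beta>2: "\<beta>2 x \<ge> 0" for x unfolding \<beta>2_def using q by (intro sum_nonneg) auto
  have \<beta>1: "\<beta>1 x \<ge> 0" if "x \<in> S" for x
    using that A c r unfolding \<beta>1_def S_def by (intro add_nonneg_nonneg mult_nonneg_nonneg divide_nonneg_pos) auto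
  have "v x - (\<beta>1 x + \<beta>2 x) \<le> 0"
  proof (rule maximum_principle_cbox[of a b])
    show "continuous_on (cbox a b) (\<lambda>x. v x - (\<beta>1 x + \<beta>2 x))"
      using cont r unfolding S \<beta>1_def \<beta>2_def by (intro continuous_intros) auto
    show "x \<in> cbox a b" using x S by simp
  next
    fix x assume "x \<in> box a b"
    then have *: "a $ k < x $ k" "x $ k < b $ k" for k by (auto simp: mem_box_cart)
    have "\<exists>l\<ge>- N. has_lap v l x"
    proof (rule lap)
      show "\<bar>x $ k - p $ k\<bar> < R" if "k \<noteq> i" for k
        using *[of k] that by (auto simp: a_def b_def abs_less_iff)
      show "T - r < x $ i" "x $ i < T" using *[of i] by (auto simp: a_def b_def)
    qed
    then obtain l where l: "l \<ge> - N" "has_lap v l x" by blast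
    have 1: "has_lap \<beta>1 (- 2 * c) x"
      unfolding \<beta>1_def
      by (rule has_lap_coord[where g = "\<lambda>t. A * (T - t) / r + c * ((T - t) * (r - (T - t)))"
            and g' = "\<lambda>t. - A / r + c * (2 * (T - t) - r)"])
        (use r in \<open>auto intro!: derivative_eq_intros simp: field_simps\<close>)
    have 2: "has_lap \<beta>2 (\<Sum>k\<in>UNIV - {i}. q / R\<^sup>2 * 2) x"
      unfolding \<beta>2_def
      by (intro has_lap_sum has_lap_cmult
          has_lap_coord[where g = "\<lambda>t. (t - p $ k)\<^sup>2" and g' = "\<lambda>t. 2 * (t - p $ k)" for k])
        (auto intro!: derivative_eq_intros)
    have "has_lap (\<lambda>x. v x - (\<beta>1 x + \<beta>2 x)) (l - (- 2 * c + (\<Sum>k\<in>UNIV - {i}. q / R\<^sup>2 * 2))) x"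
      by (intro has_lap_diff has_lap_add l 1 2)
    moreover have "(\<Sum>k\<in>UNIV - {i}. q / R\<^sup>2 * 2) \<le> ?n * (q / R\<^sup>2 * 2)"
      using q by (simp add: card_Diff_singleton_if) (intro divide_right_mono mult_right_mono; simp)
    then have "l - (- 2 * c + (\<Sum>k\<in>UNIV - {i}. q / R\<^sup>2 * 2)) \<ge> 0"
      using l(1) by (simp add: c_def)
    ultimately show "\<exists>l\<ge>0. has_lap (\<lambda>x. v x - (\<beta>1 x + \<beta>2 x)) l x" by blast
  next
    fix x k assume "x \<in> cbox a b" and k: "x $ k = a $ k \<or> x $ k = b $ k"
    then have xS: "x \<in> S" by (simp add: S)
    consider "k = i" "x $ i = T" | "k = i" "x $ i = T - r" | "k \<noteq> i" "(x $ k - p $ k)\<^sup>2 = R\<^sup>2"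
      using k by (auto simp: a_def b_def split: if_splits)
    then show "v x - (\<beta>1 x + \<beta>2 x) \<le> 0"
    proof cases
      case 1
      then show ?thesis using top[OF xS] \<beta>1[OF xS] \<beta>2[of x] by simp
    next
      case 2
      then have "\<beta>1 x = A" using r by (simp add: \<beta>1_def)
      then show ?thesis using bot[OF xS] 2 \<beta>2[of x] by simp
    next
      case 3
      have "q / R\<^sup>2 * (x $ k - p $ k)\<^sup>2 \<le> \<beta>2 x"
        unfolding \<beta>2_def using 3(1) q by (intro member_le_sum) auto
      then have "q \<le> \<beta>2 x" using 3(2) R by simp
      then show ?thesis using all[OF xS] \<beta>1[OF xS] by simp
    qed
  qed
  moreover have "\<beta>2 x = 0" using x(2) by (simp add: \<beta>2_def)
  ultimately show ?thesis by (simp add: \<beta>1_def c_def)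
qed

text \<open>A Cauchy criterion in the form that barriers deliver: all values at depth at most r are
  compared with the value at the bottom depth r.\<close>

lemma tendsto_at_right_if_Cauchy:
  fixes q :: "real \<Rightarrow> real"
  assumes "\<And>e. e > 0 \<Longrightarrow> \<exists>r>0. \<forall>y. 0 < y \<and> y \<le> r \<longrightarrow> \<bar>q y - q r\<bar> \<le> e"
  shows "\<exists>a. (q \<longlongrightarrow> a) (at_right 0)"
proof -
  define X where "X n = q (inverse (real (Suc n)))" for n
  have near: "\<exists>r>0. (\<forall>y. 0 < y \<and> y \<le> r \<longrightarrow> \<bar>q y - q r\<bar> \<le> e) \<and> (\<exists>N. \<forall>n\<ge>N. \<bar>X n - q r\<bar> \<le> e)"
    if e: "e > 0" for e
  proof -
    obtain r where r: "r > 0" "\<And>y. 0 < y \<Longrightarrow> y \<le> r \<Longrightarrow> \<bar>q y - q r\<bar> \<le> e"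
      using assms[OF e] by blast
    obtain N where N: "inverse (real (Suc N)) < r" using reals_Archimedean[OF r(1)] by blast
    have "\<bar>X n - q r\<bar> \<le> e" if "n \<ge> N" for n
    proof -
      have "inverse (real (Suc n)) \<le> inverse (real (Suc N))" using that by (intro le_imp_inverse_le) auto
      then have "inverse (real (Suc n)) \<le> r" using N by linarith
      then show ?thesis unfolding X_def by (intro r(2)) auto
    qed
    then show ?thesis using r by blast
  qed
  have "Cauchy X"
  proof (rule metric_CauchyI)
    fix e :: real assume "e > 0"
    then obtain r N where N: "\<And>n. n \<ge> N \<Longrightarrow> \<bar>X n - q r\<bar> \<le> e / 3" using near[of "e / 3"] by auto
    have "dist (X m) (X n) < e" if "m \<ge> N" "n \<ge> N" for m n
      using N[OF that(1)] N[OF that(2)] \<open>e > 0\<close> unfolding dist_real_def by linarith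
    then show "\<exists>M. \<forall>m\<ge>M. \<forall>n\<ge>M. dist (X m) (X n) < e" by blast
  qed
  then obtain a where a: "X \<longlonglongrightarrow> a" using Cauchy_convergent_iff convergent_def by blast
  have "(q \<longlongrightarrow> a) (at_right 0)"
  proof (rule tendstoI)
    fix e :: real assume "e > 0"
    then obtain r N where r: "r > 0" "\<And>y. 0 < y \<Longrightarrow> y \<le> r \<Longrightarrow> \<bar>q y - q r\<bar> \<le> e / 3"
      and N: "\<And>n. n \<ge> N \<Longrightarrow> \<bar>X n - q r\<bar> \<le> e / 3" using near[of "e / 3"] by auto
    have "(\<lambda>n. \<bar>X n - q r\<bar>) \<longlonglongrightarrow> \<bar>a - q r\<bar>" by (intro tendsto_intros a)
    then have "\<bar>a - q r\<bar> \<le> e / 3" using N by (intro LIMSEQ_le_const2) auto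
    then have "dist (q y) a < e" if "0 < y" "y < r" for y
      using r(2)[of y] that \<open>e > 0\<close> unfolding dist_real_def by linarith
    then show "\<forall>\<^sub>F y in at_right 0. dist (q y) a < e"
      unfolding eventually_at_right_field using r(1) by blast
  qed
  then show ?thesis by blast
qed

section \<open>Elementary bounds on the torsion function\<close>

text \<open>The problem pulled back by the rigid motion, reduced to what the maximum principle
  consumes. Interior differentiability enters only as a hypothesis of the final gradient
  lemmas.\<close>

locale box_torsion =
  fixes L :: "real ^ 'n" and u :: "real ^ 'n \<Rightarrow> real"
  assumes L_pos: "\<And>k. L $ k > 0"
    and cont: "continuous_on (cbox (- L) L) u"
    and lap: "\<And>x. x \<in> box (- L) L \<Longrightarrow> has_lap u (- 1) x"
    and zero: "\<And>x. x \<in> cbox (- L) L \<Longrightarrow> x \<notin> box (- L) L \<Longrightarrow> u x = 0"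
begin

abbreviation "Q \<equiv> cbox (- L) L"
abbreviation "B \<equiv> box (- L) L"

lemma in_Q: "x \<in> Q \<longleftrightarrow> (\<forall>k. \<bar>x $ k\<bar> \<le> L $ k)"
  unfolding mem_box_cart by (intro all_cong1) auto

lemma in_B: "x \<in> B \<longleftrightarrow> (\<forall>k. \<bar>x $ k\<bar> < L $ k)"
  unfolding mem_box_cart by (intro all_cong1) auto

lemma in_Q_diff_B: "x \<in> Q \<Longrightarrow> x \<notin> B \<longleftrightarrow> (\<exists>k. \<bar>x $ k\<bar> = L $ k)"
  unfolding in_Q in_B by (metis less_le not_le)

lemma zero_face: "x \<in> Q \<Longrightarrow> \<bar>x $ k\<bar> = L $ k \<Longrightarrow> u x = 0"
  using zero in_Q_diff_B by blast

lemma B_subset_Q: "B \<subseteq> Q" by (rule box_subset_cbox)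

text \<open>The right side is the torsion function of the slab |x_k| < L_k, which contains the
  box.\<close>

lemma u_le_parabola:
  assumes "x \<in> Q"
  shows "u x \<le> ((L $ k)\<^sup>2 - (x $ k)\<^sup>2) / 2"
proof -
  have "u x - ((L $ k)\<^sup>2 - (x $ k)\<^sup>2) / 2 \<le> 0"
  proof (rule maximum_principle_cbox[OF _ _ _ assms])
    show "continuous_on Q (\<lambda>x. u x - ((L $ k)\<^sup>2 - (x $ k)\<^sup>2) / 2)"
      by (intro continuous_intros cont) auto
    fix x assume "x \<in> B"
    have "has_lap (\<lambda>x. u x - ((L $ k)\<^sup>2 - (x $ k)\<^sup>2) / 2) (- 1 - (- 1)) x"
      by (intro has_lap_diff lap \<open>x \<in> B\<close>
          has_lap_coord[where g = "\<lambda>t. ((L $ k)\<^sup>2 - t\<^sup>2) / 2" and g' = "\<lambda>t. - t"])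
        (auto intro!: derivative_eq_intros)
    then show "\<exists>l\<ge>0. has_lap (\<lambda>x. u x - ((L $ k)\<^sup>2 - (x $ k)\<^sup>2) / 2) l x" by force
  next
    fix x j assume x: "x \<in> Q" "x $ j = (- L) $ j \<or> x $ j = L $ j"
    then have "\<bar>x $ j\<bar> = L $ j" using L_pos[of j] by auto
    then have "u x = 0" using zero_face x by blast
    moreover have "(x $ k)\<^sup>2 \<le> (L $ k)\<^sup>2"
      using x(1) L_pos[of k] by (intro abs_le_square_iff[THEN iffD1]) (auto simp: in_Q)
    ultimately show "u x - ((L $ k)\<^sup>2 - (x $ k)\<^sup>2) / 2 \<le> 0" by simp
  qed
  then show ?thesis by simp
qed

lemma u_le:
  assumes "x \<in> Q"
  shows "u x \<le> L $ k * (L $ k - \<bar>x $ k\<bar>)"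
proof -
  have "((L $ k)\<^sup>2 - (x $ k)\<^sup>2) / 2 = (L $ k + \<bar>x $ k\<bar>) / 2 * (L $ k - \<bar>x $ k\<bar>)"
    by (simp add: field_simps power2_eq_square)
  also have "\<dots> \<le> L $ k * (L $ k - \<bar>x $ k\<bar>)"
    using assms by (intro mult_right_mono) (auto simp: in_Q)
  finally show ?thesis using u_le_parabola[OF assms, of k] by linarith
qed

lemma u_nonneg:
  assumes "x \<in> Q"
  shows "0 \<le> u x"
proof -
  have "- u x \<le> 0"
  proof (rule maximum_principle_cbox[OF _ _ _ assms])
    show "continuous_on Q (\<lambda>x. - u x)" by (intro continuous_intros cont)
    show "\<exists>l\<ge>0. has_lap (\<lambda>x. - u x) l x" if "x \<in> B" for x
      using has_lap_minus[OF lap[OF that]] by (intro exI[of _ 1]) simp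
    fix x j assume x: "x \<in> Q" "x $ j = (- L) $ j \<or> x $ j = L $ j"
    then have "\<bar>x $ j\<bar> = L $ j" using L_pos[of j] by auto
    then show "- u x \<le> 0" using zero_face x by simp
  qed
  then show ?thesis by simp
qed

section \<open>Cosine products as lower bounds\<close>

definition \<omega> :: "'n \<Rightarrow> real" where "\<omega> k = pi / (2 * L $ k)"

lemma \<omega>_pos: "0 < \<omega> k" and \<omega>_L: "\<omega> k * L $ k = pi / 2"
  using L_pos[of k] by (auto simp: \<omega>_def)

text \<open>The first Dirichlet eigenfunction of the interval (-L_k, L_k), normalised to 1 at the
  midpoint.\<close>

definition cs :: "'n \<Rightarrow> real \<Rightarrow> real" where "cs k t = cos (\<omega> k * t)"

lemma abs_\<omega>: "\<bar>\<omega> k * t\<bar> = \<omega> k * \<bar>t\<bar>"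
  using \<omega>_pos[of k] by (simp add: abs_mult)

lemma cs_nonneg: "\<bar>t\<bar> \<le> L $ k \<Longrightarrow> 0 \<le> cs k t"
  using mult_left_mono[of "\<bar>t\<bar>" "L $ k" "\<omega> k"] \<omega>_pos[of k] unfolding cs_def
  by (intro cos_ge_zero) (auto simp: \<omega>_L simp flip: abs_\<omega>)

lemma cs_pos: "\<bar>t\<bar> < L $ k \<Longrightarrow> 0 < cs k t"
  using mult_strict_left_mono[of "\<bar>t\<bar>" "L $ k" "\<omega> k"] \<omega>_pos[of k] unfolding cs_def
  by (intro cos_gt_zero_pi) (auto simp: \<omega>_L simp flip: abs_\<omega>)

lemma cs_abs: "cs k \<bar>t\<bar> = cs k t"
  unfolding cs_def using cos_abs_real[of "\<omega> k * t"] by (simp add: abs_\<omega>)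

lemma cs_zero: "\<bar>t\<bar> = L $ k \<Longrightarrow> cs k t = 0"
  using cs_abs[of k t] by (simp add: cs_def \<omega>_L)

lemma cs_le_1: "cs k t \<le> 1"
  by (simp add: cs_def)

lemma cs_0: "cs k 0 = 1"
  by (simp add: cs_def)

lemma DERIV_cs:
  "(cs k has_real_derivative - \<omega> k * sin (\<omega> k * t)) (at t)"
  "((\<lambda>t. - \<omega> k * sin (\<omega> k * t)) has_real_derivative - (\<omega> k)\<^sup>2 * cs k t) (at t)"
  unfolding cs_def by (auto intro!: derivative_eq_intros simp: power2_eq_square)

lemma continuous_on_cs [continuous_intros]:
  fixes f :: "real ^ 'n \<Rightarrow> real"
  shows "continuous_on S f \<Longrightarrow> continuous_on S (\<lambda>x. cs k (f x))"
  unfolding cs_def by (intro continuous_on_cos continuous_on_mult continuous_on_const)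

definition \<mu> :: "'n set \<Rightarrow> real" where "\<mu> A = (\<Sum>k\<in>A. (\<omega> k)\<^sup>2)"

lemma \<mu>_UNIV_pos: "0 < \<mu> UNIV"
  unfolding \<mu>_def by (intro sum_pos zero_less_power \<omega>_pos) auto

lemma prod_cs_nonneg: "x \<in> Q \<Longrightarrow> 0 \<le> (\<Prod>k\<in>A. cs k (x $ k))"
  by (intro prod_nonneg) (auto simp: in_Q intro: cs_nonneg)

lemma prod_cs_le_1: "x \<in> Q \<Longrightarrow> (\<Prod>k\<in>A. cs k (x $ k)) \<le> 1"
  by (intro prod_le_1) (auto simp: in_Q intro: cs_nonneg cs_le_1)

lemma prod_cs_pos: "(\<And>k. k \<in> A \<Longrightarrow> \<bar>x $ k\<bar> < L $ k) \<Longrightarrow> 0 < (\<Prod>k\<in>A. cs k (x $ k))"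
  by (intro prod_pos) (auto intro: cs_pos)

text \<open>Divided by its eigenvalue, the product has Laplacian minus the product, hence at least
  -1, and it vanishes on the boundary. This lower bound with linear decay at the faces replaces the
  Hopf lemma.\<close>

lemma u_ge_prod_cs:
  assumes "x \<in> Q"
  shows "(\<Prod>k\<in>UNIV. cs k (x $ k)) / \<mu> UNIV \<le> u x"
proof -
  let ?P = "\<lambda>x. \<Prod>k\<in>UNIV. cs k (x $ k)"
  have "1 / \<mu> UNIV * ?P x - u x \<le> 0"
  proof (rule maximum_principle_cbox[OF _ _ _ assms])
    show "continuous_on Q (\<lambda>x. 1 / \<mu> UNIV * ?P x - u x)"
      by (intro continuous_intros cont)
    show "\<exists>l\<ge>0. has_lap (\<lambda>x. 1 / \<mu> UNIV * ?P x - u x) l x" if "x \<in> B" for x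
    proof -
      have "has_lap (\<lambda>x. 1 / \<mu> UNIV * ?P x - u x)
          (1 / \<mu> UNIV * ((\<Sum>k\<in>UNIV. - (\<omega> k)\<^sup>2) * ?P x) - (- 1)) x"
        by (intro has_lap_diff has_lap_cmult has_lap_prod[OF DERIV_cs] lap that)
      moreover have "1 / \<mu> UNIV * ((\<Sum>k\<in>UNIV. - (\<omega> k)\<^sup>2) * ?P x) = - ?P x"
        using \<mu>_UNIV_pos by (simp add: \<mu>_def sum_negf)
      moreover have "?P x \<le> 1" using that B_subset_Q prod_cs_le_1 by blast
      ultimately show ?thesis by (intro exI[of _ "1 - ?P x"]) auto
    qed
    fix x j assume x: "x \<in> Q" "x $ j = (- L) $ j \<or> x $ j = L $ j"
    then have j: "\<bar>x $ j\<bar> = L $ j" using L_pos[of j] by auto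
    then have "?P x = 0" by (intro prod_zero) (auto intro: cs_zero)
    then show "1 / \<mu> UNIV * ?P x - u x \<le> 0" by (simp only: zero_face[OF x(1) j])
  qed
  then show ?thesis by simp
qed

text \<open>Uniqueness: the difference is harmonic with zero boundary values. The maximum principle
  gives one inequality, and the other follows because the flip is an involution.\<close>

lemma u_sign_flip:
  assumes s: "\<And>k. s k \<in> {1, -1 :: real}" and x: "x \<in> Q"
  shows "u (\<chi> k. s k * x $ k) = u x"
proof -
  let ?\<Phi> = "\<lambda>x :: real ^ 'n. \<chi> k. s k * x $ k"
  have abs: "\<bar>?\<Phi> x $ k\<bar> = \<bar>x $ k\<bar>" for x k using s[of k] by (auto simp: abs_mult)
  have Q: "?\<Phi> x \<in> Q \<longleftrightarrow> x \<in> Q" and B: "?\<Phi> x \<in> B \<longleftrightarrow> x \<in> B" for x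
    by (simp_all only: in_Q in_B abs)
  have *: "u (?\<Phi> x) - u x \<le> 0" if "x \<in> Q" for x
  proof (rule maximum_principle_cbox[OF _ _ _ that])
    show "continuous_on Q (\<lambda>x. u (?\<Phi> x) - u x)"
      by (intro continuous_intros cont continuous_on_compose2[OF cont, of _ ?\<Phi>]) (auto simp: Q)
    show "\<exists>l\<ge>0. has_lap (\<lambda>x. u (?\<Phi> x) - u x) l x" if "x \<in> B" for x
    proof -
      have "has_lap (\<lambda>x. u (\<chi> k. s k * x $ id k + 0 $ k)) (- 1) x"
        by (rule has_lap_signed_perm[OF bij_id s]) (use that B lap in auto)
      then have "has_lap (\<lambda>x. u (?\<Phi> x)) (- 1) x" by simp
      from has_lap_diff[OF this lap[OF that]] show ?thesis by force
    qed
    fix x j assume x: "x \<in> Q" "x $ j = (- L) $ j \<or> x $ j = L $ j"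
    then have j: "\<bar>x $ j\<bar> = L $ j" using L_pos[of j] by auto
    then show "u (?\<Phi> x) - u x \<le> 0"
      using zero_face[OF x(1) j] zero_face[of "?\<Phi> x" j] abs[of x j] x(1) by (simp only: Q)
  qed
  have "s k * (s k * y) = y" for k y using s[of k] by auto
  then have "?\<Phi> (?\<Phi> x) = x" by (simp add: vec_eq_iff)
  then have "u x - u (?\<Phi> x) \<le> 0" using *[of "?\<Phi> x"] x Q by simp
  with *[OF x] show ?thesis by simp
qed

text \<open>The increment is harmonic on the overlap of the box with its translate. At the boundary
  of the overlap either x + h lies on the boundary of the box, where the increment is nonpositive
  and \<open>b_le\<close> suffices, or x does, which is the case of \<open>edge\<close>. A nonzero
  subharmonic \<open>b\<close> leaves room for a strict improvement; \<open>b = 0\<close> gives the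
  Lipschitz bound.\<close>

lemma shift_bound:
  assumes b: "continuous_on Q b" "\<And>z. z \<in> B \<Longrightarrow> \<exists>l\<ge>0. has_lap b l z"
    and b_le: "\<And>z. z \<in> Q \<Longrightarrow> b z \<le> c"
    and edge: "\<And>z. z \<in> Q - B \<Longrightarrow> z + h \<in> B \<Longrightarrow> u (z + h) + b z \<le> c"
    and x: "x \<in> Q" "x + h \<in> Q"
  shows "u (x + h) - u x + b x \<le> c"
proof -
  let ?v = "\<lambda>x. u (x + h) - u x + b x - c"
  let ?S = "Q \<inter> (\<lambda>x. x + h) -` Q" and ?G = "B \<inter> (\<lambda>x. x + h) -` B"
  have "?v x \<le> 0"
  proof (rule maximum_principle[of ?S ?v ?G])
    show "compact ?S"
      by (intro compact_Int_closed closed_vimage compact_cbox closed_cbox continuous_intros)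
    show "continuous_on ?S ?v"
      by (intro continuous_intros continuous_on_compose2[OF cont, of _ "\<lambda>x. x + h"]
          continuous_on_subset[OF b(1)] continuous_on_subset[OF cont]) auto
    show "open ?G"
      by (intro open_Int open_vimage open_box continuous_intros)
    show "?G \<subseteq> ?S" using B_subset_Q by auto
    show "x \<in> ?S" using x by simp
  next
    fix z assume z: "z \<in> ?S - ?G"
    show "?v z \<le> 0"
    proof (cases "z + h \<in> B")
      case True
      then have "z \<in> Q - B" using z by auto
      with edge[OF this True] zero[of z] show ?thesis by simp
    next
      case False
      then have "u (z + h) = 0" using z zero[of "z + h"] by simp
      with b_le[of z] u_nonneg[of z] z show ?thesis by simp
    qed
  next
    fix z assume z: "z \<in> ?G"
    then obtain l where l: "l \<ge> 0" "has_lap b l z" using b(2) by blast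
    have "has_lap ?v (- 1 - (- 1) + l - 0) z"
      using z by (intro has_lap_add has_lap_diff has_lap_const l has_lap_translate lap) auto
    then show "\<exists>l\<ge>0. has_lap ?v l z" using l(1) by auto
  qed
  then show ?thesis by simp
qed

text \<open>A constant above every L_k frees the linear bound from the choice of the face; it is
  also a Lipschitz constant of \<open>u\<close>.\<close>

definition K :: real where "K = (\<Sum>k\<in>UNIV. L $ k)"

lemma L_le_K: "L $ k \<le> K"
  unfolding K_def using L_pos by (intro member_le_sum) (auto simp: less_imp_le)

lemma K_pos: "0 < K"
  using L_le_K L_pos by (meson less_le_trans)

lemma u_le_K: "x \<in> Q \<Longrightarrow> u x \<le> K * (L $ k - \<bar>x $ k\<bar>)"
  by (rule order_trans[OF u_le[of x k]]) (auto intro!: mult_right_mono L_le_K simp: in_Q)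

lemma u_diff_le:
  assumes x: "x \<in> Q" "x + h \<in> Q"
  shows "u (x + h) - u x \<le> K * norm h"
proof -
  have "u (x + h) - u x + 0 \<le> K * norm h"
  proof (rule shift_bound[OF _ _ _ _ x])
    show "\<exists>l\<ge>0. has_lap (\<lambda>x. 0) l z" for z :: "real ^ 'n" using has_lap_const by blast
    fix z assume z: "z \<in> Q - B" "z + h \<in> B"
    then obtain k where k: "\<bar>z $ k\<bar> = L $ k" using in_Q_diff_B by blast
    \<comment> \<open>As z lies on a face of direction k, the step h reaches depth at most |h| below
      that face.\<close>
    have "u (z + h) \<le> K * (L $ k - \<bar>(z + h) $ k\<bar>)" using u_le_K z(2) B_subset_Q by blast
    also have "\<dots> \<le> K * norm h"
      using K_pos k component_le_norm_cart[of h k] by (intro mult_left_mono) auto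
    finally show "u (z + h) + 0 \<le> K * norm h" by simp
  qed (use K_pos in auto)
  then show ?thesis by simp
qed

lemma u_lipschitz:
  assumes "x \<in> Q" "y \<in> Q"
  shows "\<bar>u y - u x\<bar> \<le> K * norm (y - x)"
  using u_diff_le[of x "y - x"] u_diff_le[of y "x - y"] assms
  by (auto simp: abs_le_iff norm_minus_commute)

section \<open>Differentiability at the boundary\<close>

abbreviation e :: "'n \<Rightarrow> real ^ 'n" where "e i \<equiv> axis i 1"

text \<open>Only relative interiors of the positive faces are needed: sign flips reach the negative
  ones, and points on two faces are treated as edges.\<close>

definition open_face :: "'n \<Rightarrow> real ^ 'n \<Rightarrow> bool" where
  "open_face i z \<longleftrightarrow> z $ i = L $ i \<and> (\<forall>k. k \<noteq> i \<longrightarrow> \<bar>z $ k\<bar> < L $ k)"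

lemma open_face_in_Q: "open_face i z \<Longrightarrow> z \<in> Q"
  unfolding open_face_def in_Q using L_pos by (metis abs_of_pos less_le order_refl)

text \<open>The factor 2 leaves room for a tangential shift of length \<rho> on top of a
  displacement \<rho> inside the barrier box.\<close>

lemma open_face_radius:
  assumes "open_face i z"
  shows "\<exists>\<rho>>0. \<rho> \<le> L $ i \<and> (\<forall>k. k \<noteq> i \<longrightarrow> 2 * \<rho> \<le> L $ k - \<bar>z $ k\<bar>)"
proof -
  define \<rho> where "\<rho> = Min ((\<lambda>k. if k = i then L $ i else (L $ k - \<bar>z $ k\<bar>) / 2) ` UNIV)"
  have "\<rho> > 0"
    unfolding \<rho>_def using assms L_pos by (subst Min_gr_iff) (auto simp: open_face_def)
  moreover have *: "\<rho> \<le> (if k = i then L $ i else (L $ k - \<bar>z $ k\<bar>) / 2)" for k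
    unfolding \<rho>_def by (intro Min_le) auto
  moreover have "2 * \<rho> \<le> L $ k - \<bar>z $ k\<bar>" if "k \<noteq> i" for k
    using *[of k] that by auto
  moreover have "\<rho> \<le> L $ i" using *[of i] by simp
  ultimately show ?thesis by blast
qed

text \<open>The barrier box has half-width and height \<rho>, and A = q = K |h| by the Lipschitz
  bound, so the two barrier terms add up to the factor 1 + n. The sign \<open>s\<close> turns the
  one-sided barrier into a two-sided estimate.\<close>

lemma tangential_bound_aux:
  assumes z: "open_face i z" and \<rho>: "\<rho> > 0" "\<rho> \<le> L $ i" "\<And>k. k \<noteq> i \<Longrightarrow> 2 * \<rho> \<le> L $ k - \<bar>z $ k\<bar>"
    and h: "h $ i = 0" "norm h \<le> \<rho>" and y: "0 \<le> y" "y \<le> \<rho>" and s: "s \<in> {1, - 1 :: real}"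
  shows "s * (u (z + h - y *\<^sub>R e i) - u (z - y *\<^sub>R e i)) \<le> K * (1 + real CARD('n)) / \<rho> * norm h * y"
proof -
  let ?S = "{x. (\<forall>k. k \<noteq> i \<longrightarrow> \<bar>x $ k - z $ k\<bar> \<le> \<rho>) \<and> L $ i - \<rho> \<le> x $ i \<and> x $ i \<le> L $ i}"
  let ?v = "\<lambda>x. s * (u (x + h) - u x)" and ?x = "z - y *\<^sub>R e i" and ?q = "K * norm h"
  have hk: "\<bar>h $ k\<bar> \<le> \<rho>" for k using component_le_norm_cart[of h k] h(2) by linarith
  have SQ: "x \<in> Q" "x + h \<in> Q" if "x \<in> ?S" for x
    unfolding in_Q
  proof (safe)
    fix k
    show "\<bar>x $ k\<bar> \<le> L $ k"
      using that \<rho>(1,2) \<rho>(3)[of k] by (cases "k = i") (auto simp: abs_le_iff)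
    show "\<bar>(x + h) $ k\<bar> \<le> L $ k"
      using that \<rho>(1,2) \<rho>(3)[of k] hk[of k] h(1)
      by (cases "k = i") (auto simp: abs_le_iff dest!: spec[of _ k])
  qed
  have "?v ?x \<le> ?q * (L $ i - ?x $ i) / \<rho>
    + (real CARD('n) * ?q / \<rho>\<^sup>2 + 0 / 2) * ((L $ i - ?x $ i) * (\<rho> - (L $ i - ?x $ i)))"
  proof (rule boundary_barrier)
    show "continuous_on ?S ?v"
      by (intro continuous_intros continuous_on_compose2[OF cont, of _ "\<lambda>x. x + h"]
          continuous_on_subset[OF cont]) (use SQ in auto)
  next
    fix x assume x: "\<And>k. k \<noteq> i \<Longrightarrow> \<bar>x $ k - z $ k\<bar> < \<rho>" "L $ i - \<rho> < x $ i" "x $ i < L $ i"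
    have "x \<in> B \<and> x + h \<in> B"
      unfolding in_B
    proof (safe)
      fix k
      show "\<bar>x $ k\<bar> < L $ k"
        using x(1)[of k] x(2,3) \<rho>(1,2) \<rho>(3)[of k] by (cases "k = i") (auto simp: abs_less_iff)
      show "\<bar>(x + h) $ k\<bar> < L $ k"
        using x(1)[of k] x(2,3) \<rho>(1,2) \<rho>(3)[of k] hk[of k] h(1)
        by (cases "k = i") (auto simp: abs_less_iff abs_le_iff)
    qed
    then have "has_lap ?v (s * (- 1 - (- 1))) x"
      by (intro has_lap_cmult has_lap_diff has_lap_translate lap) auto
    then show "\<exists>l\<ge>- 0. has_lap ?v l x" by auto
  next
    fix x assume x: "x \<in> ?S"
    show "?v x \<le> 0" if "x $ i = L $ i"
      using zero_face[OF SQ(1)[OF x], of i] zero_face[OF SQ(2)[OF x], of i] that h(1) L_pos[of i] by simp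
    have "\<bar>u (x + h) - u x\<bar> \<le> K * norm h" using u_lipschitz[OF SQ[OF x]] by simp
    then show "?v x \<le> ?q" "?v x \<le> ?q" using s by auto
  next
    show "?x \<in> ?S" using \<rho>(1) y z by (auto simp: axis_def open_face_def)
  qed (use \<rho>(1) K_pos in \<open>auto simp: axis_def\<close>)
  also have "L $ i - ?x $ i = y" using z by (simp add: open_face_def axis_def)
  also have "?q * y / \<rho> + (real CARD('n) * ?q / \<rho>\<^sup>2 + 0 / 2) * (y * (\<rho> - y))
      \<le> ?q * y / \<rho> + (real CARD('n) * ?q / \<rho>\<^sup>2 + 0 / 2) * (y * \<rho>)"
    using y K_pos by (intro add_left_mono mult_left_mono) auto
  also have "\<dots> = K * (1 + real CARD('n)) / \<rho> * norm h * y"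
    using \<rho>(1) by (simp add: field_simps power2_eq_square)
  finally show ?thesis by (simp add: algebra_simps)
qed

lemma tangential_bound:
  assumes z: "open_face i z"
  shows "\<exists>\<rho>>0. \<exists>C\<ge>0. \<rho> \<le> L $ i \<and> (\<forall>k. k \<noteq> i \<longrightarrow> 2 * \<rho> \<le> L $ k - \<bar>z $ k\<bar>) \<and>
    (\<forall>h y. h $ i = 0 \<longrightarrow> norm h \<le> \<rho> \<longrightarrow> 0 \<le> y \<longrightarrow> y \<le> \<rho> \<longrightarrow>
      \<bar>u (z + h - y *\<^sub>R e i) - u (z - y *\<^sub>R e i)\<bar> \<le> C * norm h * y)"
proof -
  obtain \<rho> where \<rho>: "\<rho> > 0" "\<rho> \<le> L $ i" "\<And>k. k \<noteq> i \<Longrightarrow> 2 * \<rho> \<le> L $ k - \<bar>z $ k\<bar>"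
    using open_face_radius[OF z] by blast
  have "\<bar>u (z + h - y *\<^sub>R e i) - u (z - y *\<^sub>R e i)\<bar> \<le> K * (1 + real CARD('n)) / \<rho> * norm h * y"
    if "h $ i = 0" "norm h \<le> \<rho>" "0 \<le> y" "y \<le> \<rho>" for h y
    using tangential_bound_aux[OF z \<rho> that, of 1] tangential_bound_aux[OF z \<rho> that, of "-1"]
    by (simp add: abs_le_iff)
  then show ?thesis using \<rho> K_pos
    by (intro exI[of _ \<rho>] conjI exI[of _ "K * (1 + real CARD('n)) / \<rho>"]) auto
qed

definition depth_ratio :: "'n \<Rightarrow> real ^ 'n \<Rightarrow> real \<Rightarrow> real" where
  "depth_ratio i z y = u (z - y *\<^sub>R e i) / y"

text \<open>The tangential variation of \<open>u\<close> controls the bottom of a flat box of width \<open>R\<close> and height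
  \<open>r\<close>; on its sides the crude bound \<open>K r\<close> is enough, since \<open>r\<close> may be taken much smaller than \<open>R\<close>.\<close>

lemma depth_ratio_near_aux:
  assumes z: "open_face i z" and \<rho>: "\<rho> \<le> L $ i" "\<And>k. k \<noteq> i \<Longrightarrow> 2 * \<rho> \<le> L $ k - \<bar>z $ k\<bar>"
    and C: "C \<ge> 0" "\<And>h y. h $ i = 0 \<Longrightarrow> norm h \<le> \<rho> \<Longrightarrow> 0 \<le> y \<Longrightarrow> y \<le> \<rho> \<Longrightarrow>
        \<bar>u (z + h - y *\<^sub>R e i) - u (z - y *\<^sub>R e i)\<bar> \<le> C * norm h * y"
    and R: "R > 0" "real CARD('n) * R \<le> \<rho>" and y: "0 < y" "y \<le> r" "r \<le> R"
    and s: "s \<in> {1, - 1 :: real}"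
  shows "s * (depth_ratio i z y - depth_ratio i z r) \<le>
    C * real CARD('n) * R + (real CARD('n) * K * r / R\<^sup>2 + 1 / 2) * r"
proof -
  let ?n = "real CARD('n)"
  have "1 * R \<le> ?n * R" using R(1) by (intro mult_right_mono) auto
  then have R\<rho>: "R \<le> \<rho>" using R(2) by simp
  have r: "r > 0" using y by simp
  let ?S = "{x. (\<forall>k. k \<noteq> i \<longrightarrow> \<bar>x $ k - z $ k\<bar> \<le> R) \<and> L $ i - r \<le> x $ i \<and> x $ i \<le> L $ i}"
  \<comment> \<open>Subtracting the affine function of slope \<open>d\<close> makes
    \<open>?v\<close> vanish at the bottom point below \<open>z\<close>, so only the tangential
    variation remains on the bottom of the box.\<close>
  define d where "d = depth_ratio i z r"
  let ?v = "\<lambda>x. s * (u x - d * (L $ i - x $ i))" and ?x = "z - y *\<^sub>R e i"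
  have SQ: "x \<in> Q" if "x \<in> ?S" for x
    unfolding in_Q
  proof (safe)
    fix k
    show "\<bar>x $ k\<bar> \<le> L $ k"
      using that \<rho>(1) \<rho>(2)[of k] R(1) R\<rho> y by (cases "k = i") (auto simp: abs_le_iff dest!: spec[of _ k])
  qed
  have inS: "z - y *\<^sub>R e i \<in> ?S" if "0 \<le> y" "y \<le> r" for y
    using that z R(1) by (auto simp: open_face_def axis_def)
  have u_le_depth: "0 \<le> u x \<and> u x \<le> K * (L $ i - x $ i)" if "x \<in> ?S" for x
    using u_nonneg[OF SQ[OF that]] u_le_K[OF SQ[OF that], of i] that \<rho>(1) R\<rho> y(3) by auto
  have d: "0 \<le> d" "d \<le> K"
    using u_le_depth[OF inS[of r]] r z
    by (auto simp: d_def depth_ratio_def open_face_def axis_def field_simps)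
  \<comment> \<open>The first constant bounds the tangential variation over displacements of norm at
    most n R, \<open>K * r\<close> is the crude bound on the whole box, and 1 pays for the Laplacian
    -1 of \<open>u\<close>.\<close>
  have "?v ?x \<le> (C * ?n * R * r) * (L $ i - ?x $ i) / r
    + (?n * (K * r) / R\<^sup>2 + 1 / 2) * ((L $ i - ?x $ i) * (r - (L $ i - ?x $ i)))"
  proof (rule boundary_barrier)
    show "continuous_on ?S ?v"
      by (intro continuous_intros continuous_on_subset[OF cont]) (use SQ in auto)
  next
    fix x assume x: "\<And>k. k \<noteq> i \<Longrightarrow> \<bar>x $ k - z $ k\<bar> < R" "L $ i - r < x $ i" "x $ i < L $ i"
    have "x \<in> B"
      unfolding in_B
    proof (safe)
      fix k
      show "\<bar>x $ k\<bar> < L $ k"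
        using x(1)[of k] x(2,3) \<rho>(1) \<rho>(2)[of k] R(1) R\<rho> y by (cases "k = i") (auto simp: abs_less_iff)
    qed
    then have "has_lap ?v (s * (- 1 - d * 0)) x"
      by (intro has_lap_cmult has_lap_diff lap has_lap_coord[where g' = "\<lambda>_. - 1"])
        (auto intro!: derivative_eq_intros)
    moreover have "s * (- 1 - d * 0) \<ge> - 1" using s by auto
    ultimately show "\<exists>l\<ge>- 1. has_lap ?v l x" by blast
  next
    fix x assume x: "x \<in> ?S"
    show "?v x \<le> 0" if "x $ i = L $ i"
      using zero_face[OF SQ[OF x], of i] that L_pos[of i] by simp
    show "?v x \<le> K * r"
    proof -
      have "K * (L $ i - x $ i) \<le> K * r" using x K_pos by (intro mult_left_mono) auto
      moreover have "d * (L $ i - x $ i) \<le> K * (L $ i - x $ i)" "0 \<le> d * (L $ i - x $ i)"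
        using x d by (auto intro: mult_right_mono)
      ultimately show ?thesis using u_le_depth[OF x] s by auto
    qed
    show "?v x \<le> C * ?n * R * r" if xi: "x $ i = L $ i - r"
    proof -
      define h where "h = x - z + r *\<^sub>R e i"
      have h: "h $ i = 0" "\<And>k. \<bar>h $ k\<bar> \<le> R"
        using x xi z R(1) by (auto simp: h_def axis_def open_face_def)
      have "norm h \<le> (\<Sum>k\<in>UNIV. \<bar>h $ k\<bar>)" by (rule norm_le_l1_cart)
      also have "\<dots> \<le> (\<Sum>k\<in>(UNIV::'n set). R)" by (intro sum_mono h(2))
      finally have nh: "norm h \<le> ?n * R" by simp
      then have "\<bar>u (z + h - r *\<^sub>R e i) - u (z - r *\<^sub>R e i)\<bar> \<le> C * norm h * r"
        using h(1) R(2) r R\<rho> y(3) by (intro C(2)) auto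
      also have "\<dots> \<le> C * (?n * R) * r" using nh C(1) r by (intro mult_right_mono mult_left_mono) auto
      finally have "\<bar>u x - u (z - r *\<^sub>R e i)\<bar> \<le> C * ?n * R * r" by (simp add: h_def algebra_simps)
      moreover have "u (z - r *\<^sub>R e i) = d * r" using r by (simp add: d_def depth_ratio_def)
      ultimately show ?thesis using s xi by auto
    qed
  qed (use inS[of y] r R(1) C(1) K_pos y in \<open>auto simp: axis_def\<close>)
  also have "L $ i - ?x $ i = y" using z by (simp add: open_face_def axis_def)
  finally have "s * (u ?x - d * y) \<le> C * ?n * R * y + (?n * (K * r) / R\<^sup>2 + 1 / 2) * (y * (r - y))"
    using r by simp
  also have "\<dots> \<le> C * ?n * R * y + (?n * (K * r) / R\<^sup>2 + 1 / 2) * (y * r)"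
    using y K_pos r by (intro add_left_mono mult_left_mono) auto
  also have "\<dots> = (C * ?n * R + (?n * K * r / R\<^sup>2 + 1 / 2) * r) * y" by (simp add: algebra_simps)
  also have "u ?x = depth_ratio i z y * y" using y by (simp add: depth_ratio_def)
  finally have "(s * (depth_ratio i z y - d)) * y \<le> (C * ?n * R + (?n * K * r / R\<^sup>2 + 1 / 2) * r) * y"
    by (simp add: algebra_simps)
  then show ?thesis using y(1) unfolding d_def by (simp only: mult_le_cancel_right_pos)
qed

lemma depth_ratio_converges:
  assumes z: "open_face i z"
  shows "\<exists>a. (depth_ratio i z \<longlongrightarrow> a) (at_right 0)"
proof (rule tendsto_at_right_if_Cauchy)
  let ?n = "real CARD('n)"
  obtain \<rho> C where \<rho>: "\<rho> > 0" "\<rho> \<le> L $ i" "\<And>k. k \<noteq> i \<Longrightarrow> 2 * \<rho> \<le> L $ k - \<bar>z $ k\<bar>"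
    and C: "C \<ge> 0" "\<And>h y. h $ i = 0 \<Longrightarrow> norm h \<le> \<rho> \<Longrightarrow> 0 \<le> y \<Longrightarrow> y \<le> \<rho> \<Longrightarrow>
        \<bar>u (z + h - y *\<^sub>R e i) - u (z - y *\<^sub>R e i)\<bar> \<le> C * norm h * y"
    using tangential_bound[OF z] by blast
  fix \<epsilon> :: real assume \<epsilon>: "\<epsilon> > 0"
  \<comment> \<open>R comes first and makes the tangential term at most \<epsilon>/2. The constant
    \<open>D\<close> depends on R, and only then is r chosen with D r at most \<epsilon>/2. The
    summand 1 guards against C = 0.\<close>
  define R where "R = min (\<rho> / ?n) (\<epsilon> / (2 * (C * ?n + 1)))"
  have Cn: "C * ?n + 1 > 0" using C(1) by (intro add_nonneg_pos mult_nonneg_nonneg) auto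
  have R: "R > 0" using \<rho>(1) \<epsilon> Cn by (simp add: R_def)
  have "R \<le> \<rho> / ?n" by (simp add: R_def)
  then have R2: "?n * R \<le> \<rho>" by (simp add: field_simps)
  have "R \<le> \<epsilon> / (2 * (C * ?n + 1))" by (simp add: R_def)
  then have "(C * ?n + 1) * R \<le> \<epsilon> / 2" using Cn by (simp add: field_simps)
  then have R3: "C * ?n * R \<le> \<epsilon> / 2" using R by (simp add: algebra_simps)
  define D where "D = ?n * K / R + 1 / 2"
  have D: "D > 0" using K_pos R by (simp add: D_def add_nonneg_pos)
  define r where "r = min R (\<epsilon> / (2 * D))"
  have r: "0 < r" "r \<le> R" using R \<epsilon> D by (auto simp: r_def)
  have "r \<le> \<epsilon> / (2 * D)" by (simp add: r_def)
  then have rD: "D * r \<le> \<epsilon> / 2" using D by (simp add: field_simps)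
  have "?n * K * r / R\<^sup>2 \<le> ?n * K * R / R\<^sup>2"
    using r K_pos by (intro divide_right_mono mult_left_mono) auto
  also have "\<dots> = ?n * K / R" using R by (simp add: power2_eq_square)
  finally have "(?n * K * r / R\<^sup>2 + 1 / 2) * r \<le> D * r"
    using r unfolding D_def by (intro mult_right_mono) auto
  then have le: "C * ?n * R + (?n * K * r / R\<^sup>2 + 1 / 2) * r \<le> \<epsilon>" using rD R3 by linarith
  have "\<bar>depth_ratio i z y - depth_ratio i z r\<bar> \<le> \<epsilon>" if "0 < y" "y \<le> r" for y
    using depth_ratio_near_aux[OF z \<rho>(2,3) C R R2 that r(2), of 1]
      depth_ratio_near_aux[OF z \<rho>(2,3) C R R2 that r(2), of "-1"] le
    by (simp add: abs_le_iff)
  then show "\<exists>r>0. \<forall>y. 0 < y \<and> y \<le> r \<longrightarrow> \<bar>depth_ratio i z y - depth_ratio i z r\<bar> \<le> \<epsilon>"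
    using r(1) by blast
qed

text \<open>The inward normal derivative at a face point; \<open>Lim\<close> is meaningful only
  where the ratio converges, which is known on open faces.\<close>

definition slope :: "'n \<Rightarrow> real ^ 'n \<Rightarrow> real" where
  "slope i z = Lim (at_right 0) (depth_ratio i z)"

lemma depth_ratio_tendsto:
  assumes "open_face i z"
  shows "(depth_ratio i z \<longlongrightarrow> slope i z) (at_right 0)"
  using depth_ratio_converges[OF assms] unfolding slope_def
  by (metis tendsto_Lim trivial_limit_at_right_real)

text \<open>Write x = z + h - y e_i with h tangential. The tangential error C |h| y is quadratic in
  |x - z|, and the normal error is o(y) by the definition of the slope.\<close>

lemma face_derivative:
  assumes z: "open_face i z"
  shows "(u has_derivative (\<lambda>h. (- slope i z *\<^sub>R e i) \<bullet> h)) (at z within Q)"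
  unfolding has_derivative_within_alt
proof (intro conjI allI impI)
  show "bounded_linear (\<lambda>h. (- slope i z *\<^sub>R e i) \<bullet> h)" by (rule bounded_linear_inner_right)
  let ?a = "slope i z"
  obtain \<rho> C where \<rho>: "\<rho> > 0"
    and C: "C \<ge> 0" "\<And>h y. h $ i = 0 \<Longrightarrow> norm h \<le> \<rho> \<Longrightarrow> 0 \<le> y \<Longrightarrow> y \<le> \<rho> \<Longrightarrow>
        \<bar>u (z + h - y *\<^sub>R e i) - u (z - y *\<^sub>R e i)\<bar> \<le> C * norm h * y"
    using tangential_bound[OF z] by blast
  fix \<epsilon> :: real assume \<epsilon>: "\<epsilon> > 0"
  have "\<forall>\<^sub>F y in at_right 0. dist (depth_ratio i z y) ?a < \<epsilon> / 2"
    using depth_ratio_tendsto[OF z] \<epsilon> by (intro tendstoD) auto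
  then obtain d0 where d0: "d0 > 0"
      "\<And>y. 0 < y \<Longrightarrow> y < d0 \<Longrightarrow> dist (depth_ratio i z y) ?a < \<epsilon> / 2"
    unfolding eventually_at_right_field by blast
  \<comment> \<open>The three bounds serve, in turn, the convergence of the depth ratio, the
    condition |h| <= 2 |x - z| <= \<rho>, and the quadratic error 2 C |x - z|^2 <= \<epsilon>/2 |x -
    z|.\<close>
  define d where "d = min (min d0 (\<rho> / 2)) (\<epsilon> / (4 * (C + 1)))"
  have d: "d > 0" using d0(1) \<rho> \<epsilon> C(1) by (simp add: d_def)
  have "norm (u x - u z - (- ?a *\<^sub>R e i) \<bullet> (x - z)) \<le> \<epsilon> * norm (x - z)"
    if x: "x \<in> Q" "norm (x - z) < d" for x
  proof -
    let ?N = "norm (x - z)"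
    define y where "y = L $ i - x $ i"
    define h where "h = x - z + y *\<^sub>R e i"
    have zi: "z $ i = L $ i" using z by (simp add: open_face_def)
    have y: "0 \<le> y" "y \<le> ?N"
      using x(1) component_le_norm_cart[of "x - z" i] by (auto simp: y_def zi in_Q abs_le_iff)
    have hi: "h $ i = 0" by (simp add: h_def y_def zi axis_def)
    have "norm h \<le> ?N + norm (y *\<^sub>R e i)" unfolding h_def by (rule norm_triangle_ineq)
    then have nh: "norm h \<le> 2 * ?N" using y by simp
    have d2: "d \<le> \<rho> / 2" "d \<le> d0" "d \<le> \<epsilon> / (4 * (C + 1))" unfolding d_def by linarith+
    have "\<bar>u (z + h - y *\<^sub>R e i) - u (z - y *\<^sub>R e i)\<bar> \<le> C * norm h * y"
      using hi nh x(2) d2 y \<rho> by (intro C(2)) auto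
    also have "\<dots> \<le> C * (2 * ?N) * ?N"
      using nh y C(1) by (intro mult_mono) auto
    also have "\<dots> = (2 * C * ?N) * ?N" by simp
    also have "\<dots> \<le> \<epsilon> / 2 * ?N"
    proof (rule mult_right_mono)
      have **: "2 * C * ?N \<le> 2 * (C + 1) * (\<epsilon> / (4 * (C + 1)))"
        using x(2) d2(3) C(1) by (intro mult_mono) auto
      have "2 * c * (\<epsilon> / (4 * c)) = \<epsilon> / 2" if "c \<noteq> 0" for c :: real
        using that by (simp add: field_simps)
      from this[of "C + 1"] have *: "2 * (C + 1) * (\<epsilon> / (4 * (C + 1))) = \<epsilon> / 2" using C(1) by simp
      with ** show "2 * C * ?N \<le> \<epsilon> / 2" by linarith
    qed simp
    finally have 1: "\<bar>u x - u (z - y *\<^sub>R e i)\<bar> \<le> \<epsilon> / 2 * ?N" by (simp add: h_def)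
    have 2: "\<bar>u (z - y *\<^sub>R e i) - ?a * y\<bar> \<le> \<epsilon> / 2 * ?N"
    proof (cases "y = 0")
      case True
      then show ?thesis using zero_face[OF open_face_in_Q[OF z], of i] zi L_pos[of i] \<epsilon> by simp
    next
      case False
      then have y0: "y > 0" "y < d0" using y x(2) d2 by auto
      have "u (z - y *\<^sub>R e i) - ?a * y = (depth_ratio i z y - ?a) * y"
        using y0 by (simp add: depth_ratio_def algebra_simps)
      then have "\<bar>u (z - y *\<^sub>R e i) - ?a * y\<bar> = \<bar>depth_ratio i z y - ?a\<bar> * y"
        using y0 by (simp add: abs_mult)
      also have "\<dots> \<le> \<epsilon> / 2 * ?N"
        using d0(2)[OF y0] y \<epsilon> by (intro mult_mono) (auto simp: dist_real_def)
      finally show ?thesis .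
    qed
    have "(- ?a *\<^sub>R e i) \<bullet> (x - z) = ?a * y"
      by (simp add: inner_axis' y_def zi algebra_simps)
    moreover have "u z = 0" using zero_face[OF open_face_in_Q[OF z], of i] zi L_pos[of i] by simp
    moreover have "\<bar>u x - ?a * y\<bar> \<le> \<bar>u x - u (z - y *\<^sub>R e i)\<bar> + \<bar>u (z - y *\<^sub>R e i) - ?a * y\<bar>"
      by linarith
    then have "\<bar>u x - ?a * y\<bar> \<le> \<epsilon> * ?N" using 1 2 by linarith
    ultimately show ?thesis by simp
  qed
  then show "\<exists>d>0. \<forall>x\<in>Q. norm (x - z) < d \<longrightarrow>
      norm (u x - u z - (- ?a *\<^sub>R e i) \<bullet> (x - z)) \<le> \<epsilon> * norm (x - z)"
    using d by blast
qed

section \<open>Vanishing of the gradient at the edges\<close>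

lemma u_le_near_edge:
  assumes ij: "i \<noteq> j" and R: "0 < R" "R \<le> L $ i" "R \<le> L $ j"
    and x: "x \<in> Q" "L $ i - R \<le> x $ i" "L $ j - R \<le> x $ j"
  shows "u x \<le> K / R * ((L $ i - x $ i) * (L $ j - x $ j)) + (L $ i - x $ i) * (R - (L $ i - x $ i)) / 2"
proof -
  \<comment> \<open>Only the directions i and j are cut to width R; in the others the box ends at
    faces of the domain, where \<open>u\<close> is 0.\<close>
  define a where "a = (\<chi> k. if k = i \<or> k = j then L $ k - R else - L $ k)"
  define X where "X = (\<lambda>x::real^'n. L $ i - x $ i)"
  define Y where "Y = (\<lambda>x::real^'n. L $ j - x $ j)"
  \<comment> \<open>The product X Y is harmonic and, scaled by K / R, equals the linear bounds K Y
    on X = R and K X on Y = R. The parabola in X absorbs the Laplacian -1.\<close>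
  let ?v = "\<lambda>x. u x - (K / R * (X x * Y x) + X x * (R - X x) / 2)"
  have a_ge: "- L $ k \<le> a $ k" for k using R L_pos[of k] by (auto simp: a_def)
  have aQ: "x \<in> Q" if "x \<in> cbox a L" for x
    using that a_ge unfolding mem_box_cart by (metis order_trans vector_uminus_component)
  have aB: "x \<in> B" if "x \<in> box a L" for x
    using that a_ge unfolding mem_box_cart by (metis le_less_trans vector_uminus_component)
  have "?v x \<le> 0"
  proof (rule maximum_principle_cbox[of a L])
    show "continuous_on (cbox a L) ?v"
      unfolding X_def Y_def using aQ
      by (intro continuous_intros continuous_on_subset[OF cont]) auto
    show "x \<in> cbox a L"
      using x unfolding mem_box_cart a_def by auto
  next
    fix x assume x: "x \<in> box a L"
    let ?g = "\<lambda>k t. if k = i \<or> k = j then L $ k - t else 1"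
    have XY: "X x * Y x = (\<Prod>k\<in>UNIV. ?g k (x $ k))" for x
    proof -
      have "(\<Prod>k\<in>UNIV. ?g k (x $ k)) = (\<Prod>k\<in>{i, j}. ?g k (x $ k))"
        by (rule prod.mono_neutral_right) auto
      then show ?thesis using ij by (simp add: X_def Y_def)
    qed
    have "has_lap (\<lambda>x. \<Prod>k\<in>UNIV. ?g k (x $ k)) ((\<Sum>k\<in>(UNIV::'n set). 0) * (\<Prod>k\<in>UNIV. ?g k (x $ k))) x"
      by (rule has_lap_prod[where g = ?g and c = "\<lambda>_. 0"
            and g' = "\<lambda>k t. if k = i \<or> k = j then - 1 else 0"])
        (auto intro!: derivative_eq_intros)
    then have 1: "has_lap (\<lambda>x. X x * Y x) 0 x" by (simp add: XY)
    have 2: "has_lap (\<lambda>x. X x * (R - X x) / 2) (- 1) x"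
      unfolding X_def
      by (rule has_lap_coord[where g = "\<lambda>t. (L $ i - t) * (R - (L $ i - t)) / 2"
            and g' = "\<lambda>t. (2 * (L $ i - t) - R) / 2"])
        (auto intro!: derivative_eq_intros simp: field_simps)
    have "has_lap ?v (- 1 - (K / R * 0 + - 1)) x"
      by (intro has_lap_diff has_lap_add has_lap_cmult 1 2 lap aB x)
    then show "\<exists>l\<ge>0. has_lap ?v l x" by force
  next
    fix x k assume x: "x \<in> cbox a L" and k: "x $ k = a $ k \<or> x $ k = L $ k"
    have "a $ i \<le> x $ i" "x $ i \<le> L $ i" "a $ j \<le> x $ j" "x $ j \<le> L $ j"
      using x by (auto simp: mem_box_cart)
    then have XY: "0 \<le> X x" "X x \<le> R" "0 \<le> Y x" "Y x \<le> R"
      by (auto simp: X_def Y_def a_def)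
    have nn: "0 \<le> K / R * (X x * Y x)" "0 \<le> X x * (R - X x) / 2"
      using XY K_pos R by auto
    consider "\<bar>x $ k\<bar> = L $ k" | "X x = R" | "Y x = R"
      using k L_pos[of k] unfolding a_def X_def Y_def by (auto split: if_splits)
    then show "?v x \<le> 0"
    proof cases
      case 1
      then show ?thesis using zero_face[OF aQ[OF x]] nn by simp
    next
      case 2
      then have "K * (L $ j - \<bar>x $ j\<bar>) \<le> K / R * (X x * Y x)"
        using R K_pos by (auto simp: Y_def intro!: mult_left_mono)
      then show ?thesis using u_le_K[OF aQ[OF x], of j] nn by simp
    next
      case 3
      then have "K * (L $ i - \<bar>x $ i\<bar>) \<le> K / R * (X x * Y x)"
        using R K_pos by (auto simp: X_def intro!: mult_left_mono)
      then show ?thesis using u_le_K[OF aQ[OF x], of i] nn by simp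
    qed
  qed
  then show ?thesis by (simp add: X_def Y_def)
qed

lemma edge_derivative:
  assumes ij: "i \<noteq> j" and z: "z \<in> Q" "z $ i = L $ i" "z $ j = L $ j"
  shows "(u has_derivative (\<lambda>h. 0 \<bullet> h)) (at z within Q)"
  unfolding has_derivative_within_alt
proof (intro conjI allI impI)
  show "bounded_linear (\<lambda>h :: real ^ 'n. 0 \<bullet> h)" by (rule bounded_linear_inner_right)
  fix \<epsilon> :: real assume \<epsilon>: "\<epsilon> > 0"
  \<comment> \<open>Each term of the edge bound must be at most \<epsilon>/2 |x - z|: R <=
    \<epsilon> settles the parabola, and d <= R \<epsilon> / (2 K) settles the product.\<close>
  define R where "R = min (min (L $ i) (L $ j)) \<epsilon>"
  have R: "0 < R" "R \<le> L $ i" "R \<le> L $ j" "R \<le> \<epsilon>" using \<epsilon> L_pos by (auto simp: R_def)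
  define d where "d = min R (R * \<epsilon> / (2 * K))"
  have d: "0 < d" "d \<le> R" "d \<le> R * \<epsilon> / (2 * K)" using R \<epsilon> K_pos by (auto simp: d_def)
  have "norm (u x - u z - 0 \<bullet> (x - z)) \<le> \<epsilon> * norm (x - z)"
    if x: "x \<in> Q" "norm (x - z) < d" for x
  proof -
    let ?N = "norm (x - z)" and ?X = "L $ i - x $ i" and ?Y = "L $ j - x $ j"
    have X: "0 \<le> ?X" "?X \<le> ?N" and Y: "0 \<le> ?Y" "?Y \<le> ?N"
      using x(1) component_le_norm_cart[of "x - z" i] component_le_norm_cart[of "x - z" j] z
      by (auto simp: in_Q abs_le_iff)
    have "u x \<le> K / R * (?X * ?Y) + ?X * (R - ?X) / 2"
      using x d X Y by (intro u_le_near_edge ij R) auto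
    also have "\<dots> \<le> K / R * (?N * d) + ?N * \<epsilon> / 2"
      using X Y R K_pos x(2) d by (intro add_mono mult_left_mono mult_mono divide_right_mono) auto
    also have "K / R * (?N * d) \<le> K / R * (?N * (R * \<epsilon> / (2 * K)))"
      using d(3) K_pos R by (intro mult_left_mono) auto
    also have "\<dots> = ?N * \<epsilon> / 2" using K_pos R by simp
    finally have "u x \<le> \<epsilon> * ?N" by (simp add: mult.commute)
    moreover have "u z = 0" using zero_face[OF z(1), of i] z(2) L_pos[of i] by simp
    ultimately show ?thesis using u_nonneg[OF x(1)] by simp
  qed
  then show "\<exists>d>0. \<forall>x\<in>Q. norm (x - z) < d \<longrightarrow> norm (u x - u z - 0 \<bullet> (x - z)) \<le> \<epsilon> * norm (x - z)"
    using d(1) by blast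
qed

section \<open>Reflections and the slope on the faces\<close>

definition zero_on :: "'n set \<Rightarrow> real ^ 'n \<Rightarrow> real ^ 'n" where
  "zero_on A x = (\<chi> k. if k \<in> A then 0 else x $ k)"

lemma zero_on_in_Q: "x \<in> Q \<Longrightarrow> zero_on A x \<in> Q"
  using L_pos by (auto simp: in_Q zero_on_def less_imp_le)

lemma sign_flip_in_Q:
  assumes "\<And>k. s k \<in> {1, -1 :: real}"
  shows "(\<chi> k. s k * x $ k) \<in> Q \<longleftrightarrow> x \<in> Q"
proof -
  have "\<bar>s k * x $ k\<bar> = \<bar>x $ k\<bar>" for k using assms[of k] by (auto simp: abs_mult)
  then show ?thesis by (simp add: in_Q)
qed

definition rt :: real where "rt = sqrt (\<mu> UNIV)"

lemma rt_pos: "0 < rt" and rt_square: "rt\<^sup>2 = \<mu> UNIV"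
  using \<mu>_UNIV_pos by (auto simp: rt_def)

text \<open>The growth rate \<open>rt\<close> makes the product subharmonic wherever it is nonnegative.\<close>

lemma has_lap_sinh_prod_cs:
  assumes s: "s \<in> {1, - 1 :: real}"
  shows "has_lap (\<lambda>x. sinh (rt * (s * x $ j + c)) * (\<Prod>k\<in>-{j}. cs k (x $ k)))
    ((\<omega> j)\<^sup>2 * (sinh (rt * (s * x $ j + c)) * (\<Prod>k\<in>-{j}. cs k (x $ k)))) x"
proof -
  define g where "g = (\<lambda>k t. if k = j then sinh (rt * (s * t + c)) else cs k t)"
  define g' where "g' = (\<lambda>k t. if k = j then rt * s * cosh (rt * (s * t + c))
    else - \<omega> k * sin (\<omega> k * t))"
  define C where "C = (\<lambda>k. if k = j then rt\<^sup>2 else - (\<omega> k)\<^sup>2)"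
  have ss: "s * s = 1" using s by auto
  have eq: "(\<Prod>k\<in>UNIV. g k (x $ k)) = sinh (rt * (s * x $ j + c)) * (\<Prod>k\<in>-{j}. cs k (x $ k))" for x
  proof -
    have "(\<Prod>k\<in>UNIV. g k (x $ k)) = g j (x $ j) * (\<Prod>k\<in>UNIV - {j}. g k (x $ k))"
      by (rule prod.remove) auto
    also have "(\<Prod>k\<in>UNIV - {j}. g k (x $ k)) = (\<Prod>k\<in>-{j}. cs k (x $ k))"
      by (rule prod.cong) (auto simp: g_def)
    finally show ?thesis by (simp add: g_def)
  qed
  have "(\<Sum>k\<in>UNIV. C k) = rt\<^sup>2 + (\<Sum>k\<in>UNIV - {j}. - (\<omega> k)\<^sup>2)"
    unfolding C_def by (subst sum.remove[of _ j]) (auto intro!: sum.cong)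
  also have "\<dots> = (\<omega> j)\<^sup>2"
    unfolding rt_square \<mu>_def by (subst (1) sum.remove[of _ j]) (auto simp: sum_negf)
  finally have C: "(\<Sum>k\<in>UNIV. C k) = (\<omega> j)\<^sup>2" .
  have "has_lap (\<lambda>x. \<Prod>k\<in>UNIV. g k (x $ k)) ((\<Sum>k\<in>UNIV. C k) * (\<Prod>k\<in>UNIV. g k (x $ k))) x"
  proof (rule has_lap_prod)
    show "(g k has_real_derivative g' k t) (at t)" for k t
      using DERIV_cs(1)[of k t]
      by (cases "k = j") (auto simp: g_def g'_def intro!: derivative_eq_intros)
    show "(g' k has_real_derivative C k * g k t) (at t)" for k t
    proof (cases "k = j")
      case True
      have "((\<lambda>t. rt * s * cosh (rt * (s * t + c))) has_real_derivative
          rt * s * (sinh (rt * (s * t + c)) * (rt * s))) (at t)"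
        by (auto intro!: derivative_eq_intros)
      moreover have "rt * s * (sinh (rt * (s * t + c)) * (rt * s)) = rt\<^sup>2 * (s * s) * sinh (rt * (s * t + c))"
        by (simp add: power2_eq_square)
      ultimately show ?thesis using True by (simp add: g_def g'_def C_def ss)
    next
      case False
      then show ?thesis using DERIV_cs(2)[of k t] by (simp add: g_def g'_def C_def)
    qed
  qed
  then show ?thesis by (simp only: eq C)
qed

lemma continuous_on_sinh_prod_cs:
  "continuous_on S (\<lambda>x::real^'n. sinh (rt * (s * x $ j + c)) * (\<Prod>k\<in>-{j}. cs k (x $ k)))"
  by (intro continuous_intros)

text \<open>Reflection about \<open>x\<^sub>j = b / 2\<close> sends points with \<open>x\<^sub>j = b\<close> to points with \<open>x\<^sub>j = 0\<close>.\<close>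

lemma u_zero_coord_gap:
  assumes b: "0 < b" "b < L $ j"
  shows "\<exists>\<delta>>0. \<forall>x\<in>Q. x $ j = b \<longrightarrow> u x + \<delta> * (\<Prod>k\<in>-{j}. cs k (x $ k)) \<le> u (zero_on {j} x)"
proof -
  let ?P = "\<lambda>x. \<Prod>k\<in>-{j}. cs k (x $ k)"
  \<comment> \<open>T is the sinh factor on the far face x_j = L_j, written in the literal form of
    \<open>has_lap_sinh_prod_cs\<close>. The reflection sends that face to x_j = b - L_j, strictly
    inside, and \<delta> makes the comparison function equal there to the cosine lower bound of
    \<open>u\<close> at the reflected point.\<close>
  define T where "T = sinh (rt * (1 * L $ j + - (b / 2)))"
  define \<delta> where "\<delta> = cs j (b - L $ j) / (\<mu> UNIV * T)"
  have T_pos: "0 < T" using rt_pos b by (simp add: T_def)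
  have \<delta>: "\<delta> > 0"
    unfolding \<delta>_def using b \<mu>_UNIV_pos T_pos by (intro divide_pos_pos mult_pos_pos cs_pos) auto
  define a :: "real ^ 'n" where "a = (\<chi> k. if k = j then b / 2 else - L $ k)"
  define s :: "'n \<Rightarrow> real" where "s = (\<lambda>k. if k = j then - 1 else 1)"
  \<comment> \<open>The permutation \<open>id\<close> and the translation vector give the reflection
    the shape required by \<open>has_lap_signed_perm\<close>.\<close>
  define \<Phi> where "\<Phi> = (\<lambda>x :: real ^ 'n. \<chi> k. s k * x $ id k + (axis j b :: real ^ 'n) $ k)"
  have \<Phi>j: "\<Phi> x $ j = b - x $ j" and \<Phi>k: "k \<noteq> j \<Longrightarrow> \<Phi> x $ k = x $ k" for x k
    by (auto simp: \<Phi>_def s_def axis_def)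
  have a_ge: "- L $ k \<le> a $ k" for k using b L_pos[of k] by (auto simp: a_def)
  have bds: "- L $ k \<le> \<Phi> x $ k \<and> \<Phi> x $ k \<le> L $ k \<and> - L $ k \<le> x $ k \<and> x $ k \<le> L $ k"
    if "x \<in> cbox a L" for x k
    using that b unfolding mem_box_cart
    by (cases "k = j") (auto simp: \<Phi>j \<Phi>k a_def split: if_splits dest!: spec[of _ k])
  then have Q: "x \<in> Q" "\<Phi> x \<in> Q" if "x \<in> cbox a L" for x
    using that unfolding mem_box_cart by auto
  have bds: "- L $ k < \<Phi> x $ k \<and> \<Phi> x $ k < L $ k \<and> - L $ k < x $ k \<and> x $ k < L $ k"
    if "x \<in> box a L" for x k
    using that b unfolding mem_box_cart
    by (cases "k = j") (auto simp: \<Phi>j \<Phi>k a_def split: if_splits dest!: spec[of _ k])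
  then have B: "x \<in> B" "\<Phi> x \<in> B" if "x \<in> box a L" for x
    using that unfolding mem_box_cart by auto
  let ?\<beta> = "\<lambda>x. sinh (rt * (1 * x $ j + - (b / 2))) * ?P x"
  let ?v = "\<lambda>x. u x + \<delta> * ?\<beta> x - u (\<Phi> x)"
  have main: "?v x \<le> 0" if "x \<in> cbox a L" for x
  proof (rule maximum_principle_cbox[OF _ _ _ that])
    show "continuous_on (cbox a L) ?v"
    proof (intro continuous_on_add continuous_on_diff
        continuous_on_mult[OF continuous_on_const continuous_on_sinh_prod_cs])
      show "continuous_on (cbox a L) u" using Q by (intro continuous_on_subset[OF cont]) auto
      have "continuous_on (cbox a L) \<Phi>" unfolding \<Phi>_def by (intro continuous_intros)
      then show "continuous_on (cbox a L) (\<lambda>x. u (\<Phi> x))"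
        by (rule continuous_on_compose2[OF cont]) (use Q in auto)
    qed
  next
    fix x assume x: "x \<in> box a L"
    have "has_lap (\<lambda>x. u (\<Phi> x)) (- 1) x"
      unfolding \<Phi>_def
      by (rule has_lap_signed_perm) (use lap[OF B(2)[OF x]] in \<open>auto simp: s_def \<Phi>_def bij_id[unfolded id_def]\<close>)
    then have **: "has_lap ?v (- 1 + \<delta> * ((\<omega> j)\<^sup>2 * ?\<beta> x) - (- 1)) x"
      by (intro has_lap_add has_lap_diff has_lap_cmult lap B(1) x has_lap_sinh_prod_cs) auto
    have "0 \<le> ?P x" using prod_cs_nonneg B(1)[OF x] B_subset_Q by blast
    moreover have "b / 2 < x $ j" using x unfolding mem_box_cart a_def by (auto dest!: spec[of _ j])
    ultimately have "?\<beta> x \<ge> 0" using rt_pos by simp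
    then have "0 \<le> - 1 + \<delta> * ((\<omega> j)\<^sup>2 * ?\<beta> x) - (- 1)"
      using \<delta> by (simp add: mult_nonneg_nonneg)
    with ** show "\<exists>l\<ge>0. has_lap ?v l x" by blast
  next
    fix x k assume x: "x \<in> cbox a L" and k: "x $ k = a $ k \<or> x $ k = L $ k"
    consider "k \<noteq> j" "\<bar>x $ k\<bar> = L $ k" | "x $ j = b / 2" | "x $ j = L $ j"
      using k L_pos[of k] by (auto simp: a_def split: if_splits)
    then show "?v x \<le> 0"
    proof cases
      case 1
      then have P0: "?P x = 0" by (intro prod_zero bexI[of _ k]) (auto intro: cs_zero)
      show ?thesis using zero_face[OF Q(1)[OF x] 1(2)] u_nonneg[OF Q(2)[OF x]] by (simp add: P0)
    next
      case 2
      then have "\<Phi> x $ k = x $ k" for k by (cases "k = j") (simp_all add: \<Phi>j \<Phi>k)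
      then have "\<Phi> x = x" by (simp add: vec_eq_iff)
      then show ?thesis by (simp add: 2)
    next
      case 3
      have "(\<Prod>k\<in>UNIV. cs k (\<Phi> x $ k)) = cs j (\<Phi> x $ j) * (\<Prod>k\<in>UNIV - {j}. cs k (\<Phi> x $ k))"
        by (rule prod.remove) auto
      also have "(\<Prod>k\<in>UNIV - {j}. cs k (\<Phi> x $ k)) = ?P x" by (rule prod.cong) (auto simp: \<Phi>k)
      finally have "cs j (b - L $ j) * ?P x / \<mu> UNIV \<le> u (\<Phi> x)"
        using u_ge_prod_cs[OF Q(2)[OF x]] 3 by (simp add: \<Phi>j)
      moreover have "\<delta> * ?\<beta> x = cs j (b - L $ j) * ?P x / \<mu> UNIV"
        unfolding 3 T_def[symmetric] using T_pos by (simp add: \<delta>_def)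
      ultimately show ?thesis using zero_face[OF Q(1)[OF x], of j] 3 L_pos[of j] by simp
    qed
  qed
  have "u x + \<delta> * sinh (rt * (b / 2)) * ?P x \<le> u (zero_on {j} x)" if "x \<in> Q" "x $ j = b" for x
  proof -
    have "x \<in> cbox a L" using that b unfolding mem_box_cart by (auto simp: a_def)
    moreover have "\<Phi> x = zero_on {j} x" using that(2) by (auto simp: vec_eq_iff \<Phi>_def s_def zero_on_def axis_def)
    moreover have "1 * x $ j + - (b / 2) = b / 2" using that(2) by simp
    ultimately show ?thesis using main[of x] by (simp add: mult.assoc)
  qed
  moreover have "\<delta> * sinh (rt * (b / 2)) > 0" using \<delta> rt_pos b by simp
  ultimately show ?thesis by blast
qed

lemma u_le_zero_coord: "x \<in> Q \<Longrightarrow> u x \<le> u (zero_on {j} x)"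
proof -
  have nonneg: "u x \<le> u (zero_on {j} x)" if x: "x \<in> Q" "0 \<le> x $ j" for x
  proof -
    consider "x $ j = 0" | "x $ j = L $ j" | "0 < x $ j" "x $ j < L $ j"
      using x(2) abs_le_D1[of "x $ j" "L $ j"] x(1) unfolding in_Q by fastforce
    then show ?thesis
    proof cases
      case 1
      then have "zero_on {j} x = x" by (auto simp: zero_on_def vec_eq_iff)
      then show ?thesis by simp
    next
      case 2
      then show ?thesis
        using zero_face[OF x(1), of j] L_pos[of j] u_nonneg[OF zero_on_in_Q[OF x(1)]] by simp
    next
      case 3
      then obtain \<delta> where "\<delta> > 0" "u x + \<delta> * (\<Prod>k\<in>-{j}. cs k (x $ k)) \<le> u (zero_on {j} x)"
        using u_zero_coord_gap[OF 3] x(1) by blast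
      moreover have "0 \<le> \<delta> * (\<Prod>k\<in>-{j}. cs k (x $ k))"
        using prod_cs_nonneg[OF x(1)] \<open>\<delta> > 0\<close> by simp
      ultimately show ?thesis by linarith
    qed
  qed
  assume x: "x \<in> Q"
  show ?thesis
  proof (cases "0 \<le> x $ j")
    case True
    then show ?thesis using nonneg x by blast
  next
    case False
    define s :: "'n \<Rightarrow> real" where "s = (\<lambda>k. if k = j then - 1 else 1)"
    let ?y = "\<chi> k. s k * x $ k"
    have "u ?y = u x" by (rule u_sign_flip[OF _ x]) (auto simp: s_def)
    moreover have "u ?y \<le> u (zero_on {j} ?y)"
      using x False by (intro nonneg) (auto simp: sign_flip_in_Q s_def)
    moreover have "zero_on {j} ?y = zero_on {j} x" by (auto simp: vec_eq_iff zero_on_def s_def)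
    ultimately show ?thesis by simp
  qed
qed

lemma u_le_zero_on: "x \<in> Q \<Longrightarrow> u x \<le> u (zero_on A x)"
proof (induction A rule: finite_induct[OF finite])
  case 1
  then show ?case by (simp add: zero_on_def)
next
  case (2 j A)
  have "zero_on (insert j A) x = zero_on {j} (zero_on A x)"
    by (auto simp: zero_on_def vec_eq_iff)
  then show ?case
    using 2 u_le_zero_coord[OF zero_on_in_Q[OF \<open>x \<in> Q\<close>, of A], of j] by simp
qed

lemma open_face_depth_in_Q:
  assumes "open_face i z" "0 \<le> y" "y \<le> L $ i"
  shows "z - y *\<^sub>R e i \<in> Q"
  unfolding in_Q
proof
  fix k
  show "\<bar>(z - y *\<^sub>R e i) $ k\<bar> \<le> L $ k"
    using assms by (cases "k = i") (auto simp: open_face_def axis_def less_imp_le)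
qed

lemma eventually_depth: "\<forall>\<^sub>F y in at_right 0. 0 < y \<and> y < L $ i"
  unfolding eventually_at_right_field using L_pos by (intro exI[of _ "L $ i"]) auto

lemma open_face_zero_on: "open_face i z \<Longrightarrow> i \<notin> A \<Longrightarrow> open_face i (zero_on A z)"
  using L_pos by (auto simp: open_face_def zero_on_def)

lemma zero_on_depth: "i \<notin> A \<Longrightarrow> zero_on A (z - y *\<^sub>R e i) = zero_on A z - y *\<^sub>R e i"
  by (auto simp: zero_on_def vec_eq_iff axis_def)

lemma slope_le_zero_on:
  assumes z: "open_face i z" and A: "i \<notin> A"
  shows "slope i z \<le> slope i (zero_on A z)"
proof (rule tendsto_le[OF trivial_limit_at_right_real depth_ratio_tendsto depth_ratio_tendsto])
  show "open_face i (zero_on A z)" "open_face i z" using open_face_zero_on z A by blast+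
  show "\<forall>\<^sub>F y in at_right 0. depth_ratio i z y \<le> depth_ratio i (zero_on A z) y"
    using eventually_depth[of i]
  proof eventually_elim
    case (elim y)
    then have "u (z - y *\<^sub>R e i) \<le> u (zero_on A (z - y *\<^sub>R e i))"
      by (intro u_le_zero_on open_face_depth_in_Q[OF z]) auto
    then show ?case using elim unfolding depth_ratio_def zero_on_depth[OF A]
      by (intro divide_right_mono) auto
  qed
qed

lemma cs_depth_ratio_tendsto: "((\<lambda>y. cs i (L $ i - y) / y) \<longlongrightarrow> \<omega> i) (at_right 0)"
proof -
  have "((\<lambda>y. cs i (L $ i - y)) has_real_derivative \<omega> i) (at 0)"
    unfolding cs_def by (auto intro!: derivative_eq_intros simp: \<omega>_L)
  then have "((\<lambda>y. (cs i (L $ i - (0 + y)) - cs i (L $ i - 0)) / y) \<longlongrightarrow> \<omega> i) (at 0)"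
    by (simp only: DERIV_def)
  moreover have "cs i (L $ i) = 0" using cs_zero L_pos[of i] by simp
  ultimately have "((\<lambda>y. cs i (L $ i - y) / y) \<longlongrightarrow> \<omega> i) (at 0)" by simp
  then show ?thesis by (rule filterlim_mono) (auto simp: at_le)
qed

text \<open>The gap in \<open>u\<close> contains the factor \<open>cs i\<close>, which vanishes on
  the face at the linear rate \<omega> i. After division by the depth the positive amount \<delta> P
  \<omega>_i survives in the limit.\<close>

lemma slope_less_zero_coord:
  assumes z: "open_face i z" and j: "j \<noteq> i" "0 < z $ j"
  shows "slope i z < slope i (zero_on {j} z)"
proof -
  have "z $ j < L $ j" using z j unfolding open_face_def by (metis abs_of_pos)
  then obtain \<delta> where \<delta>: "\<delta> > 0" "\<And>x. x \<in> Q \<Longrightarrow> x $ j = z $ j \<Longrightarrow>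
      u x + \<delta> * (\<Prod>k\<in>-{j}. cs k (x $ k)) \<le> u (zero_on {j} x)"
    using u_zero_coord_gap[OF j(2)] by blast
  define P where "P = (\<Prod>k\<in>-{j}-{i}. cs k (z $ k))"
  have P: "P > 0" unfolding P_def by (rule prod_cs_pos) (use z in \<open>auto simp: open_face_def\<close>)
  have "((\<lambda>y. depth_ratio i z y + \<delta> * P * (cs i (L $ i - y) / y)) \<longlongrightarrow> slope i z + \<delta> * P * \<omega> i) (at_right 0)"
    by (intro tendsto_intros depth_ratio_tendsto z cs_depth_ratio_tendsto)
  moreover have "\<forall>\<^sub>F y in at_right 0.
      depth_ratio i z y + \<delta> * P * (cs i (L $ i - y) / y) \<le> depth_ratio i (zero_on {j} z) y"
    using eventually_depth[of i]
  proof eventually_elim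
    case (elim y)
    let ?x = "z - y *\<^sub>R e i"
    have "(\<Prod>k\<in>-{j}. cs k (?x $ k)) = cs i (?x $ i) * (\<Prod>k\<in>-{j}-{i}. cs k (?x $ k))"
      by (rule prod.remove) (use j in auto)
    also have "?x $ i = L $ i - y" using z by (simp add: open_face_def axis_def)
    also have "(\<Prod>k\<in>-{j}-{i}. cs k (?x $ k)) = P"
      unfolding P_def by (rule prod.cong) (auto simp: axis_def)
    finally have "u ?x + \<delta> * (cs i (L $ i - y) * P) \<le> u (zero_on {j} ?x)"
      using \<delta>(2)[of ?x] open_face_depth_in_Q[OF z, of y] elim j by (simp add: axis_def)
    then have "(u ?x + \<delta> * (cs i (L $ i - y) * P)) / y \<le> u (zero_on {j} ?x) / y"
      using elim by (intro divide_right_mono) auto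
    then show ?case
      using j by (simp add: depth_ratio_def zero_on_depth add_divide_distrib mult_ac)
  qed
  ultimately have "slope i z + \<delta> * P * \<omega> i \<le> slope i (zero_on {j} z)"
    by (intro tendsto_le[OF trivial_limit_at_right_real
          depth_ratio_tendsto[OF open_face_zero_on[OF z]]]) (use j in auto)
  moreover have "\<delta> * P * \<omega> i > 0" using \<delta> P \<omega>_pos by simp
  ultimately show ?thesis by linarith
qed

section \<open>Comparison of slopes at the face centers\<close>

definition center :: "'n \<Rightarrow> real ^ 'n" where "center i = axis i (L $ i)"

lemma open_face_center: "open_face i (center i)"
  using L_pos by (auto simp: open_face_def center_def axis_def)

lemma zero_on_center: "open_face i z \<Longrightarrow> zero_on (-{i}) z = center i"
  by (auto simp: open_face_def zero_on_def center_def axis_def vec_eq_iff)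

lemma slope_le_center: "open_face i z \<Longrightarrow> slope i z \<le> slope i (center i)"
  using slope_le_zero_on[of i z "-{i}"] zero_on_center by simp

text \<open>Zeroing one nonzero coordinate gains strictly, and zeroing the remaining ones loses
  nothing. The sign condition costs nothing in the end because of the flips in
  \<open>gradient_bound\<close>.\<close>

lemma slope_less_center:
  assumes z: "open_face i z" "z \<noteq> center i" "\<And>k. 0 \<le> z $ k"
  shows "slope i z < slope i (center i)"
proof -
  obtain j where j: "z $ j \<noteq> center i $ j" using z(2) by (auto simp: vec_eq_iff)
  then have "j \<noteq> i" "z $ j > 0"
    using z(1) z(3)[of j] by (auto simp: center_def open_face_def axis_def split: if_splits)
  then have "slope i z < slope i (zero_on {j} z)" using slope_less_zero_coord z(1) by blast
  also have "\<dots> \<le> slope i (center i)"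
    using \<open>j \<noteq> i\<close> by (intro slope_le_center open_face_zero_on z) auto
  finally show ?thesis .
qed

text \<open>The cosine product gives the slope \<omega>_i / \<mu> as a lower bound. Hence the
  maximal slope is positive, which excludes edges and interior critical points.\<close>

lemma slope_center_pos: "0 < slope i (center i)"
proof -
  have "((\<lambda>y. cs i (L $ i - y) / y / \<mu> UNIV) \<longlongrightarrow> \<omega> i / \<mu> UNIV) (at_right 0)"
    using \<mu>_UNIV_pos by (intro tendsto_intros cs_depth_ratio_tendsto) auto
  moreover have "\<forall>\<^sub>F y in at_right 0. cs i (L $ i - y) / y / \<mu> UNIV \<le> depth_ratio i (center i) y"
    using eventually_depth[of i]
  proof eventually_elim
    case (elim y)
    let ?x = "center i - y *\<^sub>R e i"
    have "(\<Prod>k\<in>UNIV. cs k (?x $ k)) = cs i (?x $ i) * (\<Prod>k\<in>UNIV-{i}. cs k (?x $ k))"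
      by (rule prod.remove) auto
    also have "(\<Prod>k\<in>UNIV-{i}. cs k (?x $ k)) = 1"
      by (rule prod.neutral) (auto simp: center_def axis_def cs_0)
    also have "?x $ i = L $ i - y" by (simp add: center_def axis_def)
    finally have "cs i (L $ i - y) / \<mu> UNIV \<le> u ?x"
      using u_ge_prod_cs[OF open_face_depth_in_Q[OF open_face_center, of y i]] elim by simp
    then have "cs i (L $ i - y) / \<mu> UNIV / y \<le> u ?x / y" using elim by (intro divide_right_mono) auto
    then show ?case by (simp add: depth_ratio_def mult.commute)
  qed
  ultimately have "\<omega> i / \<mu> UNIV \<le> slope i (center i)"
    by (intro tendsto_le[OF trivial_limit_at_right_real depth_ratio_tendsto[OF open_face_center]])
  moreover have "\<omega> i / \<mu> UNIV > 0" using \<omega>_pos \<mu>_UNIV_pos by simp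
  ultimately show ?thesis by linarith
qed

text \<open>The reflection maps the part of the box beyond the hyperplane \<open>x\<^sub>j = x\<^sub>i + L\<^sub>j - L\<^sub>i\<close> into the
  box and its face \<open>x\<^sub>j = L\<^sub>j\<close> into the face \<open>x\<^sub>i = L\<^sub>i\<close>.\<close>

lemma u_le_swap:
  fixes i j :: 'n
  defines "\<Phi> \<equiv> \<lambda>x :: real ^ 'n. \<chi> k. x $ Transposition.transpose i j k
    + (if k = i then L $ i - L $ j else if k = j then L $ j - L $ i else 0)"
  assumes ij: "i \<noteq> j" "L $ i \<le> L $ j" and x: "x \<in> Q" "x $ i + (L $ j - L $ i) \<le> x $ j"
  shows "u x \<le> u (\<Phi> x)"
proof -
  let ?d = "L $ j - L $ i"
  let ?S = "Q \<inter> {x. x $ i + ?d \<le> x $ j}" and ?G = "B \<inter> {x. x $ i + ?d < x $ j}"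
  have \<Phi>: "\<Phi> x $ i = x $ j - ?d" "\<Phi> x $ j = x $ i + ?d"
    "k \<noteq> i \<Longrightarrow> k \<noteq> j \<Longrightarrow> \<Phi> x $ k = x $ k" for x k
    using ij by (auto simp: \<Phi>_def)
  have SQ: "\<Phi> x \<in> Q" if "x \<in> ?S" for x
    unfolding in_Q
  proof
    fix k
    have "\<bar>x $ k\<bar> \<le> L $ k" "\<bar>x $ i\<bar> \<le> L $ i" "\<bar>x $ j\<bar> \<le> L $ j" using that by (auto simp: in_Q)
    then show "\<bar>\<Phi> x $ k\<bar> \<le> L $ k"
      using that ij by (cases "k = i"; cases "k = j") (auto simp: \<Phi> abs_le_iff)
  qed
  have GB: "\<Phi> x \<in> B" if "x \<in> ?G" for x
    unfolding in_B
  proof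
    fix k
    have "\<bar>x $ k\<bar> < L $ k" "\<bar>x $ i\<bar> < L $ i" "\<bar>x $ j\<bar> < L $ j" using that by (auto simp: in_B)
    then show "\<bar>\<Phi> x $ k\<bar> < L $ k"
      using that ij by (cases "k = i"; cases "k = j") (auto simp: \<Phi> abs_less_iff)
  qed
  have cont\<Phi>: "continuous_on S \<Phi>" for S unfolding \<Phi>_def by (intro continuous_intros)
  have "u x - u (\<Phi> x) \<le> 0"
  proof (rule maximum_principle[of ?S "\<lambda>x. u x - u (\<Phi> x)" ?G])
    show "compact ?S"
      by (intro compact_Int_closed compact_cbox closed_Collect_le continuous_intros)
    show "continuous_on ?S (\<lambda>x. u x - u (\<Phi> x))"
      by (intro continuous_on_diff continuous_on_subset[OF cont] continuous_on_compose2[OF cont cont\<Phi>])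
        (use SQ in auto)
    show "open ?G" by (intro open_Int open_box open_Collect_less continuous_intros)
    show "?G \<subseteq> ?S" using B_subset_Q by auto
    show "x \<in> ?S" using x by simp
  next
    fix x assume x: "x \<in> ?S - ?G"
    show "u x - u (\<Phi> x) \<le> 0"
    proof (cases "x \<in> B")
      case True
      then have "x $ j = x $ i + ?d" using x by auto
      then have "\<Phi> x $ k = x $ k" for k by (cases "k = i"; cases "k = j") (auto simp: \<Phi>)
      then have "\<Phi> x = x" by (simp add: vec_eq_iff)
      then show ?thesis by simp
    next
      case False
      then show ?thesis using zero[of x] u_nonneg[OF SQ[of x]] x by simp
    qed
  next
    fix x assume x: "x \<in> ?G"
    let ?b = "\<chi> k. if k = i then L $ i - L $ j else if k = j then L $ j - L $ i else 0"
    have eq: "\<Phi> = (\<lambda>x. \<chi> k. 1 * x $ Transposition.transpose i j k + ?b $ k)"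
      by (simp add: \<Phi>_def)
    have "has_lap (\<lambda>x. u (\<Phi> x)) (- 1) x"
      unfolding eq by (rule has_lap_signed_perm) (use lap[OF GB[OF x]] in \<open>auto simp: eq\<close>)
    then have "has_lap (\<lambda>x. u x - u (\<Phi> x)) (- 1 - (- 1)) x"
      using x by (intro has_lap_diff lap) auto
    then show "\<exists>l\<ge>0. has_lap (\<lambda>x. u x - u (\<Phi> x)) l x" by force
  qed
  then show ?thesis by simp
qed

lemma slope_center_le:
  assumes ij: "i \<noteq> j" "L $ i \<le> L $ j"
  shows "slope j (center j) \<le> slope i (center i + (L $ j - L $ i) *\<^sub>R e j)"
    and "open_face i (center i + (L $ j - L $ i) *\<^sub>R e j)"
proof -
  let ?z = "center i + (L $ j - L $ i) *\<^sub>R e j"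
  show z: "open_face i ?z"
    using ij L_pos by (auto simp: open_face_def center_def axis_def)
  show "slope j (center j) \<le> slope i ?z"
  proof (rule tendsto_le[OF trivial_limit_at_right_real depth_ratio_tendsto[OF z]
        depth_ratio_tendsto[OF open_face_center]])
    show "\<forall>\<^sub>F y in at_right 0. depth_ratio j (center j) y \<le> depth_ratio i ?z y"
      \<comment> \<open>The bound y < L_i keeps the normal segment below \<open>center j\<close>
        beyond the reflecting hyperplane. Its image is the segment at the same depths below the
        other point, whose j-th coordinate is L_j - L_i.\<close>
      using eventually_depth[of i]
    proof eventually_elim
      case (elim y)
      let ?x = "center j - y *\<^sub>R e j"
      have "u ?x \<le> u (\<chi> k. ?x $ Transposition.transpose i j k
          + (if k = i then L $ i - L $ j else if k = j then L $ j - L $ i else 0))"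
        using elim ij
        by (intro u_le_swap open_face_depth_in_Q open_face_center) (auto simp: center_def axis_def)
      also have "(\<chi> k. ?x $ Transposition.transpose i j k
          + (if k = i then L $ i - L $ j else if k = j then L $ j - L $ i else 0)) = ?z - y *\<^sub>R e i"
        using ij by (auto simp: vec_eq_iff center_def axis_def Transposition.transpose_def)
      finally show ?case unfolding depth_ratio_def using elim by (intro divide_right_mono) auto
    qed
  qed
qed

lemma slope_center_mono:
  assumes "L $ i \<le> L $ j"
  shows "slope j (center j) \<le> slope i (center i)"
proof (cases "i = j")
  case False
  then show ?thesis
    using slope_center_le[OF False assms] slope_le_center order_trans by blast
qed simp

lemma slope_center_strict_mono:
  assumes "L $ i < L $ j"
  shows "slope j (center j) < slope i (center i)"
proof -
  let ?z = "center i + (L $ j - L $ i) *\<^sub>R e j"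
  have ij: "i \<noteq> j" "L $ i \<le> L $ j" using assms by auto
  have "slope j (center j) \<le> slope i ?z" by (rule slope_center_le[OF ij])
  also have "slope i ?z < slope i (center i)"
  proof (rule slope_less_center[OF slope_center_le(2)[OF ij]])
    have "?z $ j \<noteq> center i $ j" using assms by (simp add: center_def axis_def)
    then show "?z \<noteq> center i" by metis
    show "0 \<le> ?z $ k" for k using assms L_pos by (auto simp: center_def axis_def less_imp_le)
  qed
  finally show ?thesis .
qed

text \<open>Uniformity along the boundary needs no compactness: flipping signs and zeroing all
  coordinates but the i-th compares x with the point at the same depth below a center, so finitely
  many one-variable limits decide.\<close>

lemma u_le_near_boundary:
  assumes M: "\<And>i. slope i (center i) < M"
  shows "\<exists>\<delta>>0. \<forall>x\<in>Q. \<forall>i. L $ i - \<bar>x $ i\<bar> < \<delta> \<longrightarrow> u x \<le> M * (L $ i - \<bar>x $ i\<bar>)"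
proof -
  have "\<forall>\<^sub>F y in at_right 0. \<forall>i\<in>UNIV. depth_ratio i (center i) y < M"
    by (intro eventually_ball_finite ballI order_tendstoD(2)[OF depth_ratio_tendsto] M open_face_center) auto
  then obtain \<delta> where \<delta>: "\<delta> > 0" "\<And>y i. 0 < y \<Longrightarrow> y < \<delta> \<Longrightarrow> depth_ratio i (center i) y < M"
    unfolding eventually_at_right_field by blast
  have "u x \<le> M * (L $ i - \<bar>x $ i\<bar>)" if x: "x \<in> Q" "L $ i - \<bar>x $ i\<bar> < \<delta>" for x i
  proof (cases "\<bar>x $ i\<bar> = L $ i")
    case True
    then show ?thesis using zero_face x(1) by simp
  next
    case False
    let ?y = "L $ i - \<bar>x $ i\<bar>"
    have y: "0 < ?y" using False x(1) by (auto simp: in_Q less_le)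
    define s :: "'n \<Rightarrow> real" where "s = (\<lambda>k. if x $ k < 0 then - 1 else 1)"
    have "u x = u (\<chi> k. s k * x $ k)" by (rule u_sign_flip[symmetric, OF _ x(1)]) (auto simp: s_def)
    also have "\<dots> \<le> u (zero_on (-{i}) (\<chi> k. s k * x $ k))"
      using x(1) by (intro u_le_zero_on) (auto simp: sign_flip_in_Q s_def)
    also have "zero_on (-{i}) (\<chi> k. s k * x $ k) = center i - ?y *\<^sub>R e i"
      by (auto simp: zero_on_def s_def center_def axis_def vec_eq_iff)
    also have "u \<dots> = depth_ratio i (center i) ?y * ?y" using y by (simp add: depth_ratio_def)
    also have "\<dots> \<le> M * ?y" using \<delta>(2)[OF y x(2), of i] y by (intro mult_right_mono) auto
    finally show ?thesis .
  qed
  then show ?thesis using \<delta>(1) by blast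
qed

section \<open>The gradient at interior points\<close>

text \<open>The order of quantifiers matters: \<theta> is the value of the comparison function at
  \<open>x0\<close> and does not depend on \<epsilon>, so the gain persists as \<epsilon> tends to
  0.\<close>

lemma directional_increment:
  assumes x0: "x0 \<in> B" and v: "norm v = 1" and M: "\<And>i. slope i (center i) \<le> M"
  shows "\<exists>\<theta>>0. \<forall>\<epsilon>>0. \<exists>\<delta>>0. \<forall>t. 0 < t \<and> t < \<delta> \<longrightarrow> x0 + t *\<^sub>R v \<in> Q \<and>
    u (x0 + t *\<^sub>R v) - u x0 \<le> (M + \<epsilon>) * t * (1 - \<theta>)"
proof -
  \<comment> \<open>Any fixed direction serves; the arbitrary value only selects one.\<close>
  define j :: 'n where "j = undefined"
  \<comment> \<open>The sinh factor grows in the direction s e_j to which v does not point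
    backwards.\<close>
  define s :: real where "s = (if 0 \<le> v $ j then 1 else - 1)"
  have s: "s \<in> {1, - 1}" by (simp add: s_def)
  define D where "D = sinh (rt * (2 * L $ j))"
  have D: "D > 0" using rt_pos L_pos[of j] by (simp add: D_def)
  let ?f = "\<lambda>x. sinh (rt * (s * x $ j + L $ j)) * (\<Prod>k\<in>-{j}. cs k (x $ k))"
  define b where "b = (\<lambda>x. 1 / D * ?f x)"
  have sx: "0 \<le> s * x $ j + L $ j" "s * x $ j + L $ j \<le> 2 * L $ j" if "x \<in> Q" for x
  proof -
    have "\<bar>x $ j\<bar> \<le> L $ j" using that in_Q by blast
    then show "0 \<le> s * x $ j + L $ j" "s * x $ j + L $ j \<le> 2 * L $ j"
      using s by (auto simp: abs_le_iff)
  qed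
  have b: "0 \<le> b x" "b x \<le> 1" if x: "x \<in> Q" for x
  proof -
    have "0 \<le> rt * (s * x $ j + L $ j)" "rt * (s * x $ j + L $ j) \<le> rt * (2 * L $ j)"
      using sx[OF x] rt_pos by (auto intro: mult_left_mono)
    then have "0 \<le> sinh (rt * (s * x $ j + L $ j))" "sinh (rt * (s * x $ j + L $ j)) \<le> D"
      unfolding D_def by (simp_all only: sinh_real_nonneg_iff sinh_real_le_iff)
    moreover note prod_cs_nonneg[OF x, of "-{j}"] prod_cs_le_1[OF x, of "-{j}"]
    ultimately have "0 \<le> ?f x" "?f x \<le> D * 1"
      using D by (intro mult_nonneg_nonneg mult_mono; simp)+
    then show "0 \<le> b x" "b x \<le> 1" using D by (auto simp: b_def)
  qed
  have x0_less: "\<bar>x0 $ k\<bar> < L $ k" for k using x0 in_B by blast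
  then have "0 < (\<Prod>k\<in>-{j}. cs k (x0 $ k))" by (intro prod_cs_pos)
  moreover have "0 < s * x0 $ j + L $ j" using x0_less[of j] s by (auto simp: abs_less_iff)
  ultimately have b_pos: "b x0 > 0" using D rt_pos by (simp add: b_def)
  \<comment> \<open>\<open>b\<close> vanishes on every face except s x_j = L_j, and from that face a
    step along v cannot enter the open box. So \<open>b\<close> costs nothing where the increment is
    compared with (M + \<epsilon>) t.\<close>
  have b_zero: "b z = 0" if z: "z \<in> Q" "\<bar>z $ m\<bar> = L $ m" "z + t *\<^sub>R v \<in> B" "t > 0" for z m t
  proof (cases "m = j \<and> s * z $ j = L $ j")
    case True
    have "\<bar>v $ j\<bar> = s * v $ j" by (simp add: s_def)
    then have "s * (z + t *\<^sub>R v) $ j = L $ j + t * \<bar>v $ j\<bar>" using True by (simp add: algebra_simps)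
    moreover have "s * (z + t *\<^sub>R v) $ j \<le> \<bar>(z + t *\<^sub>R v) $ j\<bar>" using s by auto
    moreover have "\<bar>(z + t *\<^sub>R v) $ j\<bar> < L $ j" using z(3) in_B by blast
    moreover have "0 \<le> t * \<bar>v $ j\<bar>" using z(4) by simp
    ultimately show ?thesis by linarith
  next
    case False
    have "s * z $ j = L $ j \<or> s * z $ j + L $ j = 0" if "m = j"
      using z(2) s that by (auto simp: abs_if split: if_splits)
    with False consider "m \<noteq> j" | "s * z $ j + L $ j = 0" by blast
    then show ?thesis
    proof cases
      case 1
      then have "(\<Prod>k\<in>-{j}. cs k (z $ k)) = 0"
        using z(2) by (intro prod_zero bexI[of _ m]) (auto intro: cs_zero)
      then show ?thesis by (simp add: b_def)
    next
      case 2
      then show ?thesis by (simp add: b_def)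
    qed
  qed
  have M_pos: "M > 0" by (rule less_le_trans[OF slope_center_pos M])
  have "\<exists>\<delta>>0. \<forall>t. 0 < t \<and> t < \<delta> \<longrightarrow> x0 + t *\<^sub>R v \<in> Q \<and>
      u (x0 + t *\<^sub>R v) - u x0 \<le> (M + \<epsilon>) * t * (1 - b x0)" if \<epsilon>: "\<epsilon> > 0" for \<epsilon>
  proof -
    have "slope i (center i) < M + \<epsilon>" for i using M[of i] \<epsilon> by linarith
    from u_le_near_boundary[OF this] obtain \<delta>1 where \<delta>1: "\<delta>1 > 0"
        "\<And>x i. x \<in> Q \<Longrightarrow> L $ i - \<bar>x $ i\<bar> < \<delta>1 \<Longrightarrow> u x \<le> (M + \<epsilon>) * (L $ i - \<bar>x $ i\<bar>)"
      by blast
    obtain \<delta>2 where \<delta>2: "\<delta>2 > 0" "ball x0 \<delta>2 \<subseteq> B" using x0 open_contains_ball open_box by blast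
    have "x0 + t *\<^sub>R v \<in> Q \<and> u (x0 + t *\<^sub>R v) - u x0 \<le> (M + \<epsilon>) * t * (1 - b x0)"
      if t: "0 < t" "t < \<delta>1" "t < \<delta>2" for t
    proof
      have "x0 + t *\<^sub>R v \<in> ball x0 \<delta>2" using t v by (simp add: dist_norm)
      then show Q: "x0 + t *\<^sub>R v \<in> Q" using \<delta>2(2) B_subset_Q by blast
      define c where "c = (M + \<epsilon>) * t"
      have c: "c > 0" using M_pos \<epsilon> t by (simp add: c_def)
      have "u (x0 + t *\<^sub>R v) - u x0 + c * b x0 \<le> c"
      proof (rule shift_bound[OF _ _ _ _ _ Q])
        show "continuous_on Q (\<lambda>x. c * b x)"
          unfolding b_def by (intro continuous_on_mult[OF continuous_on_const] continuous_on_sinh_prod_cs)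
        show "x0 \<in> Q" using x0 B_subset_Q by blast
        show "c * b z \<le> c" if "z \<in> Q" for z using b(2)[OF that] c by simp
        show "\<exists>l\<ge>0. has_lap (\<lambda>x. c * b x) l z" if z: "z \<in> B" for z
        proof -
          have "0 \<le> b z" using b z B_subset_Q by blast
          then have "0 \<le> (\<omega> j)\<^sup>2 * (c * b z)" using c by simp
          also have "\<dots> = c * (1 / D * ((\<omega> j)\<^sup>2 * ?f z))" by (simp only: b_def mult_ac)
          finally have "0 \<le> c * (1 / D * ((\<omega> j)\<^sup>2 * ?f z))" .
          moreover have "has_lap (\<lambda>x. c * b x) (c * (1 / D * ((\<omega> j)\<^sup>2 * ?f z))) z"
            unfolding b_def by (intro has_lap_cmult has_lap_sinh_prod_cs s)
          ultimately show ?thesis by blast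
        qed
      next
        fix z assume z: "z \<in> Q - B" "z + t *\<^sub>R v \<in> B"
        then obtain m where m: "\<bar>z $ m\<bar> = L $ m" using in_Q_diff_B by blast
        let ?y = "L $ m - \<bar>(z + t *\<^sub>R v) $ m\<bar>"
        have "\<bar>t * v $ m\<bar> \<le> t * 1"
          using component_le_norm_cart[of v m] v t by (simp add: abs_mult)
        then have y: "?y \<le> t" using m by simp
        have "u (z + t *\<^sub>R v) \<le> (M + \<epsilon>) * ?y"
          using z(2) B_subset_Q y t by (intro \<delta>1(2)) auto
        also have "\<dots> \<le> c" unfolding c_def using y M_pos \<epsilon> by (intro mult_left_mono) auto
        finally show "u (z + t *\<^sub>R v) + c * b z \<le> c" using b_zero[OF _ m z(2) t(1)] z(1) by simp
      qed
      then show "u (x0 + t *\<^sub>R v) - u x0 \<le> (M + \<epsilon>) * t * (1 - b x0)"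
        by (simp add: c_def algebra_simps)
    qed
    then show ?thesis using \<delta>1(1) \<delta>2(1) by (intro exI[of _ "min \<delta>1 \<delta>2"]) auto
  qed
  then show ?thesis using b_pos by blast
qed

lemma interior_gradient_less:
  assumes x0: "x0 \<in> B" and der: "(u has_derivative (\<lambda>h. D \<bullet> h)) (at x0 within Q)"
    and M: "\<And>i. slope i (center i) \<le> M"
  shows "norm D < M"
proof (cases "D = 0")
  case True
  then show ?thesis using less_le_trans[OF slope_center_pos M] by simp
next
  case False
  define v where "v = D /\<^sub>R norm D"
  have v: "norm v = 1" "D \<bullet> v = norm D"
    using False by (auto simp: v_def inner_commute dot_square_norm power2_eq_square)
  obtain \<theta> where \<theta>: "\<theta> > 0" "\<And>\<epsilon>. \<epsilon> > 0 \<Longrightarrow> \<exists>\<delta>>0. \<forall>t. 0 < t \<and> t < \<delta> \<longrightarrow> x0 + t *\<^sub>R v \<in> Q \<and>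
      u (x0 + t *\<^sub>R v) - u x0 \<le> (M + \<epsilon>) * t * (1 - \<theta>)"
    using directional_increment[OF x0 v(1) M] by blast
  have "norm D - \<epsilon> \<le> (M + \<epsilon>) * (1 - \<theta>)" if \<epsilon>: "\<epsilon> > 0" for \<epsilon>
  proof -
    obtain \<delta> where \<delta>: "\<delta> > 0" "\<And>t. 0 < t \<Longrightarrow> t < \<delta> \<Longrightarrow> x0 + t *\<^sub>R v \<in> Q \<and>
        u (x0 + t *\<^sub>R v) - u x0 \<le> (M + \<epsilon>) * t * (1 - \<theta>)" using \<theta>(2)[OF \<epsilon>] by blast
    obtain \<delta>' where \<delta>': "\<delta>' > 0" "\<And>y. y \<in> Q \<Longrightarrow> norm (y - x0) < \<delta>' \<Longrightarrow>
        norm (u y - u x0 - D \<bullet> (y - x0)) \<le> \<epsilon> * norm (y - x0)"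
      using der \<epsilon> unfolding has_derivative_within_alt by blast
    define t where "t = min \<delta> \<delta>' / 2"
    have t: "0 < t" "t < \<delta>" "t < \<delta>'" using \<delta>(1) \<delta>'(1) by (auto simp: t_def)
    have "norm (u (x0 + t *\<^sub>R v) - u x0 - D \<bullet> (t *\<^sub>R v)) \<le> \<epsilon> * t"
      using \<delta>'(2)[of "x0 + t *\<^sub>R v"] \<delta>(2)[OF t(1,2)] t v(1) by simp
    then have "t * norm D - \<epsilon> * t \<le> u (x0 + t *\<^sub>R v) - u x0" using v(2) by (simp add: abs_le_iff)
    also have "\<dots> \<le> (M + \<epsilon>) * t * (1 - \<theta>)" using \<delta>(2)[OF t(1,2)] by blast
    finally have "(norm D - \<epsilon>) * t \<le> ((M + \<epsilon>) * (1 - \<theta>)) * t" by (simp add: algebra_simps)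
    then show ?thesis using t(1) by (simp only: mult_le_cancel_right_pos)
  qed
  then have *: "norm D - M * (1 - \<theta>) \<le> (2 - \<theta>) * \<epsilon>" if "\<epsilon> > 0" for \<epsilon>
    using that by (force simp: algebra_simps)
  have M_pos: "M > 0" by (rule less_le_trans[OF slope_center_pos M])
  \<comment> \<open>The choice \<epsilon> = M \<theta> / 4 bounds the error by M \<theta> / 2, less
    than the gain M \<theta>.\<close>
  have "(2 - \<theta>) * (M * \<theta> / 4) < M * \<theta>"
  proof -
    have "(2 - \<theta>) * (M * \<theta> / 4) \<le> 2 * (M * \<theta> / 4)"
      using M_pos \<theta>(1) by (intro mult_right_mono) auto
    also have "\<dots> < M * \<theta>" using M_pos \<theta>(1) by simp
    finally show ?thesis .
  qed
  then show ?thesis using *[of "M * \<theta> / 4"] M_pos \<theta>(1) by (simp add: algebra_simps)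
qed

section \<open>The maximum of the gradient\<close>

lemma slope_nonneg:
  assumes "open_face i z"
  shows "0 \<le> slope i z"
proof (rule tendsto_lowerbound[OF depth_ratio_tendsto[OF assms] _ trivial_limit_at_right_real])
  show "\<forall>\<^sub>F y in at_right 0. 0 \<le> depth_ratio i z y"
    using eventually_depth[of i]
  proof eventually_elim
    case (elim y)
    then show ?case
      unfolding depth_ratio_def using u_nonneg[OF open_face_depth_in_Q[OF assms, of y]] by simp
  qed
qed

text \<open>In this orthant a boundary point lies only on faces x_i = L_i. Interior points and edges
  stay strictly below the maximal slope, so equality is possible only on an open face, where the
  strict slope comparisons apply.\<close>

lemma gradient_nonneg_orthant:
  assumes diff: "\<And>x. x \<in> B \<Longrightarrow> u differentiable at x"
    and i0: "\<And>j. L $ i0 \<le> L $ j" and x: "x \<in> Q" "\<And>k. 0 \<le> x $ k"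
  shows "\<exists>D. (u has_derivative (\<lambda>h. D \<bullet> h)) (at x within Q) \<and>
    norm D \<le> slope i0 (center i0) \<and>
    (norm D = slope i0 (center i0) \<longrightarrow> (\<exists>i. x = center i \<and> (\<forall>j. L $ i \<le> L $ j)))"
proof -
  let ?M = "slope i0 (center i0)"
  have M: "slope i (center i) \<le> ?M" for i by (rule slope_center_mono[OF i0])
  show ?thesis
  proof (cases "x \<in> B")
    case True
    then obtain f' where f': "(u has_derivative f') (at x)"
      using diff differentiable_def by blast
    then have "linear f'" by (rule has_derivative_linear)
    then have "f' = (\<lambda>h. adjoint f' 1 \<bullet> h)"
      using adjoint_works[of f' _ 1] by (auto simp: fun_eq_iff inner_commute)
    then have D: "(u has_derivative (\<lambda>h. adjoint f' 1 \<bullet> h)) (at x within Q)"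
      using f' has_derivative_at_withinI by metis
    from interior_gradient_less[OF True D M] D show ?thesis by (metis less_le)
  next
    case False
    then obtain i where "\<bar>x $ i\<bar> = L $ i" using in_Q_diff_B x(1) by blast
    then have i: "x $ i = L $ i" using x(2)[of i] by simp
    show ?thesis
    proof (cases "\<exists>j. j \<noteq> i \<and> x $ j = L $ j")
      case True
      then obtain j where "i \<noteq> j" "x $ j = L $ j" by metis
      from edge_derivative[OF this(1) x(1) i this(2)] slope_center_pos[of i0]
      show ?thesis by (intro exI[of _ 0]) auto
    next
      case False
      have "\<bar>x $ k\<bar> < L $ k" if "k \<noteq> i" for k
      proof -
        have "\<bar>x $ k\<bar> \<le> L $ k" using x(1) in_Q by blast
        then show ?thesis using False that x(2)[of k] by (auto simp: less_le)
      qed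
      then have z: "open_face i x" using i by (simp add: open_face_def)
      have norm: "norm (- slope i x *\<^sub>R e i) = slope i x" using slope_nonneg[OF z] by simp
      have "slope i x \<le> ?M" using slope_le_center[OF z] M order_trans by blast
      moreover have "x = center i \<and> (\<forall>j. L $ i \<le> L $ j)" if eq: "slope i x = ?M"
      proof
        show xc: "x = center i"
          using slope_less_center[OF z _ x(2)] M[of i] eq by force
        have "\<not> L $ i0 < L $ i" using slope_center_strict_mono[of i0 i] eq xc by auto
        then show "\<forall>j. L $ i \<le> L $ j" using i0 by (meson not_less order_trans)
      qed
      ultimately show ?thesis using face_derivative[OF z] norm by metis
    qed
  qed
qed

lemma norm_sign_flip:
  assumes "\<And>k. s k \<in> {1, -1 :: real}"
  shows "norm (\<chi> k. s k * D $ k) = norm (D :: real ^ 'n)"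
proof -
  have "(s k)\<^sup>2 = 1" for k using assms[of k] by auto
  then show ?thesis by (simp add: norm_vec_def L2_set_def power_mult_distrib)
qed

lemma gradient_bound:
  assumes diff: "\<And>x. x \<in> B \<Longrightarrow> u differentiable at x"
    and i0: "\<And>j. L $ i0 \<le> L $ j" and x: "x \<in> Q"
  shows "\<exists>D. (u has_derivative (\<lambda>h. D \<bullet> h)) (at x within Q) \<and>
    norm D \<le> slope i0 (center i0) \<and>
    (norm D = slope i0 (center i0) \<longrightarrow>
      (\<exists>i. \<exists>\<sigma>\<in>{1, -1}. x = axis i (\<sigma> * L $ i) \<and> (\<forall>j. L $ i \<le> L $ j)))"
proof -
  define s :: "'n \<Rightarrow> real" where "s = (\<lambda>k. if x $ k < 0 then - 1 else 1)"
  have s: "s k \<in> {1, - 1}" for k by (simp add: s_def)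
  define \<Phi> where "\<Phi> = (\<lambda>x :: real ^ 'n. \<chi> k. s k * x $ k)"
  have "s k * (s k * y) = y" for k y by (simp add: s_def)
  then have \<Phi>\<Phi>: "\<Phi> (\<Phi> y) = y" for y by (simp add: \<Phi>_def vec_eq_iff)
  have \<Phi>Q: "\<Phi> y \<in> Q \<longleftrightarrow> y \<in> Q" for y unfolding \<Phi>_def by (rule sign_flip_in_Q[OF s])
  have u\<Phi>: "u y = u (\<Phi> y)" if "y \<in> Q" for y
    unfolding \<Phi>_def by (rule u_sign_flip[OF s that, symmetric])
  \<comment> \<open>\<Phi> is its own adjoint, so the gradient at x is the flipped gradient at
    \<Phi> x.\<close>
  have inner: "D \<bullet> \<Phi> h = \<Phi> D \<bullet> h" for D h by (simp add: \<Phi>_def inner_vec_def mult_ac)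
  have "linear \<Phi>" by (rule linearI) (auto simp: \<Phi>_def vec_eq_iff algebra_simps)
  then have der\<Phi>: "(\<Phi> has_derivative \<Phi>) (at x within Q)"
    by (simp add: linear_imp_has_derivative)
  have "0 \<le> \<Phi> x $ k" for k by (simp add: \<Phi>_def s_def)
  then obtain D where D: "(u has_derivative (\<lambda>h. D \<bullet> h)) (at (\<Phi> x) within Q)"
      "norm D \<le> slope i0 (center i0)"
      "norm D = slope i0 (center i0) \<Longrightarrow> \<exists>i. \<Phi> x = center i \<and> (\<forall>j. L $ i \<le> L $ j)"
    using gradient_nonneg_orthant[OF diff i0, of "\<Phi> x"] x \<Phi>Q by blast
  have "\<Phi> ` Q \<subseteq> Q" using \<Phi>Q by auto
  then have "((\<lambda>y. u (\<Phi> y)) has_derivative (\<lambda>h. D \<bullet> \<Phi> h)) (at x within Q)"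
    by (intro has_derivative_in_compose[OF der\<Phi>] has_derivative_subset[OF D(1)])
  then have "(u has_derivative (\<lambda>h. \<Phi> D \<bullet> h)) (at x within Q)"
    using inner has_derivative_transform[OF x u\<Phi>] by simp
  moreover have "norm (\<Phi> D) = norm D" unfolding \<Phi>_def by (rule norm_sign_flip[OF s])
  moreover have "\<exists>i. \<exists>\<sigma>\<in>{1, -1}. x = axis i (\<sigma> * L $ i) \<and> (\<forall>j. L $ i \<le> L $ j)"
    if eq: "norm D = slope i0 (center i0)"
  proof -
    obtain i where i: "\<Phi> x = center i" "\<forall>j. L $ i \<le> L $ j" using D(3)[OF eq] by blast
    then have "x = \<Phi> (center i)" using \<Phi>\<Phi> by metis
    then have "x = axis i (s i * L $ i)" by (auto simp: \<Phi>_def center_def axis_def vec_eq_iff)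
    then show ?thesis using i(2) s by blast
  qed
  ultimately show ?thesis using D(2) by (intro exI[of _ "\<Phi> D"]) auto
qed

end

section \<open>Transfer to the image of the box under a rigid motion\<close>

lemma gradient_within_eq:
  assumes "(u has_derivative (\<lambda>h. D \<bullet> h)) (at x within S)"
    and "\<And>D'. (u has_derivative (\<lambda>h. D' \<bullet> h)) (at x within S) \<Longrightarrow> D' = D"
  shows "gradient_within u S x = D"
  unfolding gradient_within_def using assms by (rule the_equality)

lemma gradient_has_derivative:
  fixes u :: "real ^ 'n \<Rightarrow> real"
  assumes "u differentiable at x"
  shows "(u has_derivative (\<lambda>h. gradient u x \<bullet> h)) (at x)"
proof -
  obtain f' where f': "(u has_derivative f') (at x)" using assms differentiable_def by blast
  then have "linear f'" by (rule has_derivative_linear)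
  then have eq: "f' = (\<lambda>h. adjoint f' 1 \<bullet> h)"
    using adjoint_works[of f' _ 1] by (auto simp: fun_eq_iff inner_commute)
  have "gradient u x = adjoint f' 1"
  proof (rule gradient_within_eq)
    show 1: "(u has_derivative (\<lambda>h. adjoint f' 1 \<bullet> h)) (at x)" using f' eq by metis
    fix D' assume "(u has_derivative (\<lambda>h. D' \<bullet> h)) (at x)"
    then have "(\<lambda>h. D' \<bullet> h) = (\<lambda>h. adjoint f' 1 \<bullet> h)" using 1 by (rule has_derivative_unique)
    then show "D' = adjoint f' 1" by (metis vector_eq_rdot)
  qed
  then show ?thesis using f' eq by metis
qed

text \<open>The summands are the diagonal entries of F^T A F for the matrix F of \<open>f\<close>,
  and cyclicity of the trace removes F.\<close>

lemma trace_orthogonal_transformation: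
  fixes A :: "real ^ 'n ^ 'n" and f :: "real ^ 'n \<Rightarrow> real ^ 'n"
  assumes f: "orthogonal_transformation f"
  shows "(\<Sum>k\<in>UNIV. (A *v f (axis k 1)) \<bullet> f (axis k 1)) = trace A"
proof -
  define F where "F = matrix f"
  have F: "f x = F *v x" for x
    unfolding F_def using f by (simp add: orthogonal_transformation_linear matrix_works)
  have "orthogonal_matrix F" unfolding F_def using f orthogonal_transformation_matrix by blast
  then have FF: "F ** transpose F = mat 1" by (simp add: orthogonal_matrix_def)
  have "(A *v f (axis k 1)) \<bullet> f (axis k 1) = (transpose F ** (A ** F)) $ k $ k" for k
  proof -
    have "(A *v (F *v axis k 1)) \<bullet> (F *v axis k 1) = ((A *v (F *v axis k 1)) v* F) \<bullet> axis k 1"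
      by (rule dot_lmul_matrix[symmetric])
    also have "\<dots> = ((transpose F ** (A ** F)) *v axis k 1) \<bullet> axis k 1"
      by (simp only: transpose_matrix_vector[symmetric] matrix_vector_mul_assoc)
    also have "\<dots> = (transpose F ** (A ** F)) $ k $ k"
      by (simp add: matrix_vector_mult_basis inner_axis column_def)
    finally show ?thesis by (simp add: F)
  qed
  then have "(\<Sum>k\<in>UNIV. (A *v f (axis k 1)) \<bullet> f (axis k 1)) = trace (transpose F ** (A ** F))"
    by (simp add: trace_def)
  also have "\<dots> = trace ((A ** F) ** transpose F)" by (rule trace_mul_sym)
  also have "\<dots> = trace A" by (simp add: matrix_mul_assoc[symmetric] FF)
  finally show ?thesis .
qed

text \<open>Coordinate lines are mapped to lines along the rotated frame, where the second
  derivatives are values of the Hessian form; their sum is its trace. Here the full second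
  differentiability of \<open>u\<close> is used.\<close>

lemma has_lap_isometry:
  fixes u :: "real ^ 'n \<Rightarrow> real" and f :: "real ^ 'n \<Rightarrow> real ^ 'n"
  assumes C2: "C2_on \<Omega> u" and \<Omega>: "open \<Omega>" "c + f x \<in> \<Omega>" and f: "orthogonal_transformation f"
  shows "has_lap (\<lambda>x. u (c + f x)) (laplacian u (c + f x)) x"
proof -
  let ?p = "c + f x" and ?H = "hessian u (c + f x)"
  have lin: "linear f" using f by (rule orthogonal_transformation_linear)
  have d1: "(u has_derivative (\<lambda>h. gradient u y \<bullet> h)) (at y)" if "y \<in> \<Omega>" for y
    using C2 \<Omega>(1) that unfolding C2_on_def
    by (intro gradient_has_derivative) (auto simp: differentiable_on_eq_differentiable_at)
  have "gradient u differentiable at ?p"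
    using C2 \<Omega> unfolding C2_on_def by (auto simp: differentiable_on_eq_differentiable_at)
  then have d2: "(gradient u has_derivative (\<lambda>h. ?H *v h)) (at ?p)"
    unfolding hessian_def by (rule iffD1[OF jacobian_works])
  have "has_d2 (\<lambda>t. u (c + f (x + t *\<^sub>R axis k 1))) ((?H *v f (axis k 1)) \<bullet> f (axis k 1))" for k
  proof -
    let ?w = "f (axis k 1)"
    have eq: "c + f (x + t *\<^sub>R axis k 1) = ?p + t *\<^sub>R ?w" for t
      using lin by (simp add: linear_add linear_scale)
    have line: "((\<lambda>t. ?p + t *\<^sub>R ?w) has_derivative (\<lambda>s. s *\<^sub>R ?w)) (at t)" for t
      by (auto intro!: derivative_eq_intros)
    have "((\<lambda>t. ?p + t *\<^sub>R ?w) \<longlongrightarrow> ?p + 0 *\<^sub>R ?w) (nhds 0)"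
      by (intro tendsto_intros) (simp add: filterlim_ident)
    then have "\<forall>\<^sub>F t in nhds 0. ?p + t *\<^sub>R ?w \<in> \<Omega>"
      using topological_tendstoD \<Omega> by fastforce
    then have "\<forall>\<^sub>F t in nhds 0. ((\<lambda>t. u (?p + t *\<^sub>R ?w)) has_real_derivative
        gradient u (?p + t *\<^sub>R ?w) \<bullet> ?w) (at t)"
    proof eventually_elim
      case (elim t)
      from has_derivative_compose[OF line d1[OF elim]]
      show ?case by (simp add: has_field_derivative_def mult_commute_abs)
    qed
    moreover have "((\<lambda>t. gradient u (?p + t *\<^sub>R ?w) \<bullet> ?w) has_real_derivative (?H *v ?w) \<bullet> ?w) (at 0)"
    proof -
      have "(gradient u has_derivative (\<lambda>h. ?H *v h)) (at (?p + 0 *\<^sub>R ?w))" using d2 by simp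
      from has_derivative_inner_left[OF has_derivative_compose[OF line this], of ?w]
      show ?thesis
        by (simp add: has_field_derivative_def matrix_vector_mult_scaleR mult_commute_abs)
    qed
    ultimately show ?thesis
      unfolding has_d2_def eq by (intro exI[of _ "\<lambda>t. gradient u (?p + t *\<^sub>R ?w) \<bullet> ?w"]) auto
  qed
  then show ?thesis
    unfolding has_lap_def laplacian_def trace_orthogonal_transformation[OF f, symmetric]
    by (intro exI[of _ "\<lambda>k. (?H *v f (axis k 1)) \<bullet> f (axis k 1)"]) auto
qed

text \<open>The description by \<open>THE\<close> requires uniqueness on a rotated box. Any
  competing derivative is pulled back to the axis-parallel closed box, where derivatives within the
  set are unique even at corners.\<close>

lemma gradient_within_isometry:
  fixes u :: "real ^ 'n \<Rightarrow> real" and a b :: "real ^ 'n" and f :: "real ^ 'n \<Rightarrow> real ^ 'n"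
  assumes f: "orthogonal_transformation f" and ab: "\<And>k. a $ k < b $ k" and x: "x \<in> cbox a b"
    and der: "((\<lambda>x. u (c + f x)) has_derivative (\<lambda>h. D \<bullet> h)) (at x within cbox a b)"
  shows "gradient_within u ((\<lambda>x. c + f x) ` cbox a b) (c + f x) = f D"
proof (rule gradient_within_eq)
  let ?S = "(\<lambda>x. c + f x) ` cbox a b"
  have f': "orthogonal_transformation (inv f)" using f by (rule orthogonal_transformation_inv)
  have bij: "bij f" using f by (rule orthogonal_transformation_bij)
  have ff: "f (inv f y) = y" "inv f (f y) = y" for y
    using bij by (auto simp: bij_is_surj surj_f_inv_f bij_is_inj)
  define g where "g = (\<lambda>y. inv f (y - c))"
  have gf: "g (c + f y) = y" "c + f (g y) = y" for y by (simp_all add: g_def ff)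
  have dg: "(g has_derivative inv f) (at y within T)" for y T
    unfolding g_def
    by (rule has_derivative_compose[where g = "inv f" and g' = "inv f" and f' = "\<lambda>h. h"])
      (auto intro!: derivative_eq_intros linear_imp_has_derivative orthogonal_transformation_linear f')
  have "((\<lambda>x. u (c + f x)) has_derivative (\<lambda>h. D \<bullet> h)) (at (g (c + f x)) within g ` ?S)"
    using der by (simp add: gf image_image)
  from has_derivative_in_compose[OF dg this]
  have "(u has_derivative (\<lambda>h. D \<bullet> inv f h)) (at (c + f x) within ?S)"
    by (simp add: gf)
  moreover have "D \<bullet> inv f h = f D \<bullet> h" for h
    using f ff(1) unfolding orthogonal_transformation_def by metis
  ultimately show "(u has_derivative (\<lambda>h. f D \<bullet> h)) (at (c + f x) within ?S)" by simp
  fix D' assume D': "(u has_derivative (\<lambda>h. D' \<bullet> h)) (at (c + f x) within ?S)"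
  have "((\<lambda>x. c + f x) has_derivative f) (at x within cbox a b)"
    by (auto intro!: derivative_eq_intros linear_imp_has_derivative orthogonal_transformation_linear f)
  from has_derivative_in_compose[OF this D']
  have "(\<lambda>h. D \<bullet> h) = (\<lambda>h. D' \<bullet> f h)"
    by (intro frechet_derivative_unique_within_closed_interval[OF _ x der])
      (auto simp: Basis_vec_def inner_axis ab)
  then have "D' \<bullet> f h = f D \<bullet> f h" for h
    using f unfolding orthogonal_transformation_def by metis
  from this[of "inv f h" for h] have "\<forall>h. D' \<bullet> h = f D \<bullet> h" by (simp add: ff)
  then show "D' = f D" by (simp only: vector_eq_rdot)
qed

text \<open>Two face volumes share all factors except one, which is 2 L_i for direction j and 2 L_j
  for direction i.\<close>

lemma largest_face_if_shortest:
  fixes L :: "real ^ 'n"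
  assumes L: "\<And>k. L $ k > 0" and i: "\<And>j. L $ i \<le> L $ j" and s: "s \<in> {1, - 1}"
  shows "largest_face L i s"
  unfolding largest_face_def
proof (intro conjI allI ballI s)
  fix j and t :: real assume t: "t \<in> {1, - 1}"
  have "(\<Prod>k\<in>-{j}. 2 * L $ k) \<le> (\<Prod>k\<in>-{i}. 2 * L $ k)"
  proof (cases "i = j")
    case False
    have "(\<Prod>k\<in>-{j}. 2 * L $ k) = 2 * L $ i * (\<Prod>k\<in>-{j}-{i}. 2 * L $ k)"
      using False by (intro prod.remove) auto
    also have "\<dots> \<le> 2 * L $ j * (\<Prod>k\<in>-{j}-{i}. 2 * L $ k)"
      using i[of j] L by (intro mult_right_mono prod_nonneg) (auto simp: less_imp_le)
    also have "-{j}-{i} = -{i}-{j}" by auto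
    also have "2 * L $ j * (\<Prod>k\<in>-{i}-{j}. 2 * L $ k) = (\<Prod>k\<in>-{i}. 2 * L $ k)"
      using False by (intro prod.remove[symmetric]) auto
    finally show ?thesis .
  qed simp
  then show "hyperplane_volume j (box_face L j t) \<le> hyperplane_volume i (box_face L i s)"
    using hyperplane_volume_box_face[OF L t] hyperplane_volume_box_face[OF L s] by simp
qed

theorem mainTheorem6:
  fixes \<Omega> :: "(real ^ 'n) set" and u :: "real ^ 'n \<Rightarrow> real"
    and L c :: "real ^ 'n" and f :: "real ^ 'n \<Rightarrow> real ^ 'n"
  assumes "CARD('n) \<ge> 2"
    and "\<And>i. L $ i > 0"
    and "orthogonal_transformation f"
    and "\<Omega> = (\<lambda>x. c + f x) ` box (- L) L"
    and "torsion_function \<Omega> u"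
  shows "max_gradient_points \<Omega> u \<noteq> {} \<and>
    max_gradient_points \<Omega> u \<subseteq> {c + f (face_center L i s) | i s. largest_face L i s}"
proof -
  note L_pos = assms(2) and f = assms(3) and \<Omega> = assms(4) and u = assms(5)
  let ?g = "\<lambda>x. c + f x" and ?U = "\<lambda>x. u (c + f x)"
  have lin: "linear f" using f by (rule orthogonal_transformation_linear)
  have inj: "inj f" using f by (rule orthogonal_transformation_inj)
  have image: "?g ` S = (+) c ` f ` S" for S by (simp add: image_image)
  have less: "(- L) $ k < L $ k" for k using L_pos[of k] by simp
  then have ne: "box (- L) L \<noteq> {}" by (simp only: interval_ne_empty_cart) blast
  have closure: "closure \<Omega> = ?g ` cbox (- L) L"
    unfolding \<Omega> image closure_translation closure_injective_linear_image[OF lin inj, symmetric] closure_box[OF ne] ..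
  have "surj f" using f by (rule orthogonal_transformation_surj)
  then have "open \<Omega>"
    unfolding \<Omega> image by (intro open_translation open_surjective_linear_image open_box lin)
  have in_\<Omega>: "?g x \<in> \<Omega> \<longleftrightarrow> x \<in> box (- L) L" for x
    unfolding \<Omega> by (auto simp: inj_eq[OF inj])
  have cont_g: "continuous_on S ?g" for S
    by (intro continuous_intros linear_continuous_on lin linear_conv_bounded_linear[THEN iffD1])
  interpret box_torsion L ?U
  proof
    show "continuous_on (cbox (- L) L) ?U"
      by (rule continuous_on_compose2[OF _ cont_g])
        (use u closure in \<open>auto simp: torsion_function_def\<close>)
    show "has_lap ?U (- 1) x" if "x \<in> box (- L) L" for x
    proof -
      have gx: "?g x \<in> \<Omega>" using that in_\<Omega> by blast
      then have "laplacian u (?g x) = - 1" "C2_on \<Omega> u"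
        using u unfolding torsion_function_def by fastforce+
      with has_lap_isometry[OF this(2) \<open>open \<Omega>\<close> gx f] show ?thesis by simp
    qed
    show "?U x = 0" if "x \<in> cbox (- L) L" "x \<notin> box (- L) L" for x
    proof -
      have "?g x \<in> frontier \<Omega>"
        unfolding frontier_def interior_open[OF \<open>open \<Omega>\<close>] closure using that in_\<Omega> by auto
      then show ?thesis using u by (auto simp: torsion_function_def)
    qed
  qed (rule L_pos)
  have diff: "?U differentiable at x" if "x \<in> box (- L) L" for x
  proof -
    have "u differentiable at (?g x)"
      using u that in_\<Omega> \<open>open \<Omega>\<close>
      by (auto simp: torsion_function_def C2_on_def differentiable_on_eq_differentiable_at)
    moreover have "?g differentiable at x"
      by (intro differentiable_add differentiable_const linear_imp_differentiable lin)
    ultimately show ?thesis using differentiable_chain_at[of ?g x u] by (simp add: o_def)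
  qed
  obtain i0 where i0: "\<And>j. L $ i0 \<le> L $ j"
    using ex_min_if_finite[of "range (($) L)"] by (auto simp: not_less)
  define M where "M = slope i0 (center i0)"
  have grad: "norm (gradient_within u (closure \<Omega>) (?g x)) \<le> M \<and>
      (norm (gradient_within u (closure \<Omega>) (?g x)) = M \<longrightarrow>
        (\<exists>i s. ?g x = c + f (face_center L i s) \<and> largest_face L i s))"
    if x: "x \<in> cbox (- L) L" for x
  proof -
    obtain D where D: "(?U has_derivative (\<lambda>h. D \<bullet> h)) (at x within cbox (- L) L)" "norm D \<le> M"
      "norm D = M \<longrightarrow> (\<exists>i. \<exists>s\<in>{1, -1}. x = axis i (s * L $ i) \<and> (\<forall>j. L $ i \<le> L $ j))"
      using gradient_bound[OF diff i0 x] unfolding M_def by blast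
    have "gradient_within u (closure \<Omega>) (?g x) = f D"
      unfolding closure by (rule gradient_within_isometry[OF f less x D(1)])
    then have "norm (gradient_within u (closure \<Omega>) (?g x)) = norm D"
      using orthogonal_transformation_norm[OF f] by simp
    then show ?thesis
      using D(2,3) largest_face_if_shortest[OF L_pos] unfolding face_center_def by metis
  qed
  \<comment> \<open>So far M is only an upper bound. It is attained at the center of a face in a
    shortest direction, so the set of maximum points is nonempty and each of them has gradient norm
    exactly M.\<close>
  have center_Q: "center i0 \<in> cbox (- L) L" by (rule open_face_in_Q[OF open_face_center])
  have "gradient_within u (closure \<Omega>) (?g (center i0)) = f (- M *\<^sub>R axis i0 1)"
    unfolding closure M_def
    by (rule gradient_within_isometry[OF f less center_Q face_derivative[OF open_face_center]])
  then have center: "norm (gradient_within u (closure \<Omega>) (?g (center i0))) = M"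
    using slope_center_pos[of i0] by (simp add: orthogonal_transformation_norm[OF f] M_def)
  have "?g (center i0) \<in> max_gradient_points \<Omega> u"
    unfolding max_gradient_points_def using grad center center_Q by (auto simp: closure)
  moreover have "p \<in> {c + f (face_center L i s) | i s. largest_face L i s}"
    if p: "p \<in> max_gradient_points \<Omega> u" for p
  proof -
    obtain x where x: "x \<in> cbox (- L) L" "p = ?g x"
      using p by (auto simp: max_gradient_points_def closure)
    have "M \<le> norm (gradient_within u (closure \<Omega>) (?g x))"
      using p center_Q center x(2) unfolding max_gradient_points_def by (force simp: closure)
    then show ?thesis using grad[OF x(1)] x(2) by auto
  qed
  ultimately show ?thesis by blast
qed

end
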